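(* Let $\varphi$ be an affine $\mathbb{Z}^p$-action on $T^q$ and let $\psi$ be the principal affine $\mathbb{Z}^p$-action of $\varphi$. Then: (i) If $\varphi$ is a free $\mathbb{Z}^p$-action, then $\psi$ is a free $\mathbb{Z}^p$-action. (ii) If $\varphi$ is a minimal $\mathbb{Z}^p$-action, then $\psi$ is a minimal $\mathbb{Z}^p$-action. (iii) If $\varphi$ is a 1-cohomologically rigid $\mathbb{Z}^p$-action, then $\psi$ is 1-cohomologically rigid.
   Context: Here $p,q\ge 1$ and $T^q=\mathbb{R}^q/\mathbb{Z}^q$. $\mathrm{Affine}(T^q)$ is the group of affine transformations ${\bf x}\mapsto B{\bf x}+{\bf a}$ of $T^q$, with $B\in GL(q,\mathbb{Z})$ and ${\bf a}\in T^q$. An affine $\mathbb{Z}^p$-action on $T^q$ is a homomorphism $\varphi:\mathbb{Z}^p\to\mathrm{Affine}(T^q)$; its linear part is the $\mathbb{Z}^p$-action ${\bf A}:\mathbb{Z}^p\to GL(q,\mathbb{Z})$ induced on $H_1(T^q,\mathbb{Z})=\mathbb{Z}^q$. Principal affine action. For each $\ell\in\mathbb{Z}^p$ choose a lift of $\varphi(\ell)$ to $\mathbb{R}^q$ and write it as $x\mapsto {\bf A}(\ell)(x)+\widetilde\alpha(\ell)$ with $\widetilde\alpha(\ell)\in\mathbb{R}^q$. Then $k(\ell,\ell')=\widetilde\alpha(\ell)-\widetilde\alpha(\ell+\ell')+{\bf A}(\ell)\widetilde\alpha(\ell')$ lies in $\mathbb{Z}^q$, and $k$ is a 2-cocycle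 over ${\bf A}$ whose class is torsion in $H^2(\mathbb{Z}^p,\mathbb{Z}^q_{\bf A})$; hence there are $s\in\mathbb{N}$, $s\ge1$, and a map $\widetilde\beta:\mathbb{Z}^p\to\mathbb{Z}^q$ such that $s\,k(\ell,\ell')=\widetilde\beta(\ell)-\widetilde\beta(\ell+\ell')+{\bf A}(\ell)(\widetilde\beta(\ell'))$ for all $\ell,\ell'\in\mathbb{Z}^p$. Put $\widetilde\alpha_1(\ell)=\widetilde\alpha(\ell)-\frac1s\widetilde\beta(\ell)$. Then $\widetilde\alpha_1$ satisfies $\widetilde\alpha_1(\ell+\ell')=\widetilde\alpha_1(\ell)+{\bf A}(\ell)\widetilde\alpha_1(\ell')$, so that $\widetilde\psi(\ell)(x)={\bf A}(\ell)(x)+\widetilde\alpha_1(\ell)$ defines an affine $\mathbb{Z}^p$-action on $\mathbb{R}^q$, inducing an affine $\mathbb{Z}^p$-action $\psi$ on $T^q$. This $\psi$ is called the principal affine $\mathbb{Z}^p$-action of $\varphi$. An action $\varphi$ is free if $\varphi(\ell)$ has no fixed point for every $\ell\in\mathbb{Z}^p-\{0\}$; it is minimal if every orbit is dense in $T^q$; it is 1-cohomologically rigid if every smooth real 1-cocycle is cohomologous to a constant one, i.e. for every map $c:\mathbb{Z}^p\to C^\infty(T^q,\mathbb{R})$ with $c(\ell+\ell')=c(\ell)+c(\ell')\circ\varphi(\ell)$ for all $\ell,\ell'\in\mathbb{Z}^p$, there are a homomorphism $\lambda:\mathbb{Z}^p\to\mathbb{R}$ and $f\in C^\infty(T^q,\mathbb{R})$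 with $c(\ell)=\lambda(\ell)+f\circ\varphi(\ell)-f$ for all $\ell\in\mathbb{Z}^p$. *)

theory Defs
  imports "HOL-Analysis.Analysis"
begin

section \<open>Integral vectors\<close>

definition real_vec :: "int ^ 'q \<Rightarrow> real ^ 'q" where
  "real_vec n = (\<chi> i. real_of_int (n $ i))"

abbreviation real_mat :: "int ^ 'q::finite ^ 'r::finite \<Rightarrow> real ^ 'q ^ 'r" where
  "real_mat B \<equiv> map_matrix real_of_int B"

lemma real_vec_nth [simp]: "real_vec n $ i = real_of_int (n $ i)"
  by (simp add: real_vec_def)

lemma real_vec_0 [simp]: "real_vec 0 = 0"
  and real_vec_add: "real_vec (m + n) = real_vec m + real_vec n"
  and real_vec_diff: "real_vec (m - n) = real_vec m - real_vec n"
  and real_vec_minus: "real_vec (- n) = - real_vec n"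
  and real_vec_eq_iff [simp]: "real_vec m = real_vec n \<longleftrightarrow> m = n"
  by (simp_all add: vec_eq_iff)

lemma real_vec_mult: "real_vec (B *v n) = real_mat B *v real_vec n"
  by (simp add: vec_eq_iff matrix_vector_mult_def)


section \<open>The torus\<close>

quotient_type (overloaded) 'q torus = "real ^ 'q::finite" /
    "\<lambda>x y. \<exists>n :: int ^ 'q. x - y = real_vec n"
  morphisms rep_torus torus_proj
proof (rule equivpI)
  show "reflp (\<lambda>x y :: real ^ 'q. \<exists>n :: int ^ 'q. x - y = real_vec n)"
    by (rule reflpI) (metis diff_self real_vec_0)
  show "symp (\<lambda>x y :: real ^ 'q. \<exists>n :: int ^ 'q. x - y = real_vec n)"
    by (rule sympI) (metis minus_diff_eq real_vec_minus)
  show "transp (\<lambda>x y :: real ^ 'q. \<exists>n :: int ^ 'q. x - y = real_vec n)"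
  proof (rule transpI)
    fix x y z :: "real ^ 'q"
    assume "\<exists>n :: int ^ 'q. x - y = real_vec n" "\<exists>n :: int ^ 'q. y - z = real_vec n"
    then obtain m n :: "int ^ 'q" where "x - y = real_vec m" "y - z = real_vec n"
      by blast
    then have "x - z = real_vec (m + n)"
      by (simp add: real_vec_add algebra_simps)
    then show "\<exists>n :: int ^ 'q. x - z = real_vec n" ..
  qed
qed

lemma torus_proj_eq_iff: "torus_proj x = torus_proj y \<longleftrightarrow> (\<exists>n. x - y = real_vec n)"
  by (rule torus.abs_eq_iff)

lemma torus_proj_surj: "\<exists>x. t = torus_proj x"
  by (rule torus.abs_induct) blast

instantiation torus :: (finite) ab_group_add
begin

lift_definition zero_torus :: "'a torus" is "0 :: real ^ 'a" .

lift_definition plus_torus :: "'a torus \<Rightarrow> 'a torus \<Rightarrow> 'a torus"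
  is "(+) :: real ^ 'a \<Rightarrow> _"
  by (metis add_diff_add real_vec_add)

lift_definition uminus_torus :: "'a torus \<Rightarrow> 'a torus"
  is "uminus :: real ^ 'a \<Rightarrow> _"
  by (metis minus_diff_minus real_vec_minus)

lift_definition minus_torus :: "'a torus \<Rightarrow> 'a torus \<Rightarrow> 'a torus"
  is "(-) :: real ^ 'a \<Rightarrow> _"
proof -
  fix x x' y y' :: "real ^ 'a"
  assume "\<exists>n :: int ^ 'a. x - x' = real_vec n" "\<exists>n :: int ^ 'a. y - y' = real_vec n"
  then obtain m n :: "int ^ 'a" where "x - x' = real_vec m" "y - y' = real_vec n"
    by blast
  then have "x - y - (x' - y') = real_vec (m - n)"
    by (simp add: real_vec_diff algebra_simps)
  then show "\<exists>n :: int ^ 'a. x - y - (x' - y') = real_vec n" ..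
qed

instance
proof
  fix a b c :: "'a torus"
  obtain x y z where xyz: "a = torus_proj x" "b = torus_proj y" "c = torus_proj z"
    using torus_proj_surj[of a] torus_proj_surj[of b] torus_proj_surj[of c] by blast
  show "a + b + c = a + (b + c)" "a + b = b + a" "a - b = a + - b"
    unfolding xyz plus_torus.abs_eq uminus_torus.abs_eq minus_torus.abs_eq
    by (simp_all only: ac_simps diff_conv_add_uminus)
  show "0 + a = a" "- a + a = 0"
    unfolding xyz plus_torus.abs_eq uminus_torus.abs_eq zero_torus_def by simp_all
qed

end

instantiation torus :: (finite) topological_space
begin

definition open_torus :: "'a torus set \<Rightarrow> bool" where
  "open_torus U \<longleftrightarrow> open (torus_proj -` U)"

instance
proof
  show "open (UNIV :: 'a torus set)"
    by (simp add: open_torus_def)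
  show "open (S \<inter> T)" if "open S" "open T" for S T :: "'a torus set"
    using that by (simp add: open_torus_def open_Int)
  show "open (\<Union>K)" if "\<forall>S\<in>K. open S" for K :: "'a torus set set"
    using that by (auto simp: open_torus_def vimage_Union)
qed

end

lift_definition torus_mat :: "int ^ 'q ^ 'q \<Rightarrow> 'q::finite torus \<Rightarrow> 'q torus"
  is "\<lambda>B x. real_mat B *v x"
  by (metis matrix_vector_mult_diff_distrib real_vec_mult)

text \<open>
  Smoothness is of class \<open>C\<^sup>k\<close> for all \<open>k\<close>; a function on the torus is smooth iff its pullback
  along the covering projection is.
\<close>

primrec class_C :: "nat \<Rightarrow> ('a::real_normed_vector \<Rightarrow> 'b::real_normed_vector) \<Rightarrow> bool" where
  "class_C 0 g \<longleftrightarrow> continuous_on UNIV g"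
| "class_C (Suc k) g \<longleftrightarrow>
     (\<exists>g'. (\<forall>x. (g has_derivative g' x) (at x)) \<and> (\<forall>v. class_C k (\<lambda>x. g' x v)))"

definition smooth_on_torus :: "('q::finite torus \<Rightarrow> real) \<Rightarrow> bool" where
  "smooth_on_torus f \<longleftrightarrow> (\<forall>k. class_C k (\<lambda>x. f (torus_proj x)))"


section \<open>Affine actions and their linear parts\<close>

definition Affine :: "('q::finite torus \<Rightarrow> 'q torus) set" where
  "Affine = {f. \<exists>B a. invertible B \<and> f = (\<lambda>x. torus_mat B x + a)}"

definition affine_action :: "(int ^ 'p::finite \<Rightarrow> 'q::finite torus \<Rightarrow> 'q torus) \<Rightarrow> bool" where
  "affine_action \<phi> \<longleftrightarrow> range \<phi> \<subseteq> Affine \<and> (\<forall>l l'. \<phi> (l + l') = \<phi> l \<circ> \<phi> l')"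

definition is_lift :: "(real ^ 'q \<Rightarrow> real ^ 'q) \<Rightarrow> ('q::finite torus \<Rightarrow> 'q torus) \<Rightarrow> bool" where
  "is_lift F f \<longleftrightarrow> continuous_on UNIV F \<and> (\<forall>x. torus_proj (F x) = f (torus_proj x))"

text \<open>
  The map induced on \<open>H\<^sub>1(T\<^sup>q, \<int>) = \<int>\<^sup>q\<close>: the class of \<open>n\<close> is represented by the image in the torus
  of the segment from \<open>x\<close> to \<open>x + n\<close>, and a lift \<open>F\<close> of \<open>f\<close> takes this segment to a path from \<open>F x\<close>
  to \<open>F (x + n)\<close>, whose image in the torus represents the class \<open>F (x + n) - F x\<close>.
\<close>

definition linear_part :: "('q::finite torus \<Rightarrow> 'q torus) \<Rightarrow> int ^ 'q ^ 'q" where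
  "linear_part f =
     (THE B. \<forall>F. is_lift F f \<longrightarrow> (\<forall>x n. F (x + real_vec n) = F x + real_vec (B *v n)))"

lemma is_lift_affine:
  "is_lift (\<lambda>x. real_mat B *v x + a) (\<lambda>t. torus_mat B t + torus_proj a)"
  unfolding is_lift_def
  by (auto simp: torus_mat.abs_eq plus_torus.abs_eq
      intro!: continuous_intros)

lemma is_lift_unique:
  assumes "is_lift F f" "is_lift G f"
  obtains n where "\<And>x. F x = G x + real_vec n"
proof -
  have int: "\<exists>n. F x - G x = real_vec n" for x
    using assms by (metis is_lift_def torus_proj_eq_iff)
  have "(\<lambda>x. (F x - G x) $ i) constant_on UNIV" for i
  proof (rule continuous_discrete_range_constant)
    show "continuous_on UNIV (\<lambda>x. (F x - G x) $ i)"
      using assms by (auto simp: is_lift_def intro!: continuous_intros)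
    show "\<exists>e>0. \<forall>y. y \<in> UNIV \<and> (F y - G y) $ i \<noteq> (F x - G x) $ i \<longrightarrow>
            e \<le> norm ((F y - G y) $ i - (F x - G x) $ i)" for x
    proof (intro exI[of _ 1] conjI allI impI)
      fix y assume *: "y \<in> UNIV \<and> (F y - G y) $ i \<noteq> (F x - G x) $ i"
      obtain m n where mn: "F y - G y = real_vec m" "F x - G x = real_vec n"
        using int by metis
      with * show "1 \<le> norm ((F y - G y) $ i - (F x - G x) $ i)"
        by simp
    qed simp
  qed auto
  then have "F x - G x = F 0 - G 0" for x
    unfolding vec_eq_iff constant_on_def by (metis UNIV_I)
  moreover obtain n where "F 0 - G 0 = real_vec n"
    using int by blast
  ultimately show ?thesis
    by (intro that[of n]) (simp add: diff_eq_eq add.commute)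
qed

lemma linear_part_affine: "linear_part (\<lambda>t. torus_mat B t + a) = B"
proof -
  obtain a' where a: "a = torus_proj a'"
    using torus_proj_surj by blast
  show ?thesis
    unfolding linear_part_def
  proof (rule the_equality)
    show "\<forall>F. is_lift F (\<lambda>t. torus_mat B t + a) \<longrightarrow>
            (\<forall>x n. F (x + real_vec n) = F x + real_vec (B *v n))"
    proof (intro allI impI)
      fix F x n
      assume "is_lift F (\<lambda>t. torus_mat B t + a)"
      then obtain m where "\<And>x. F x = real_mat B *v x + a' + real_vec m"
        using is_lift_unique is_lift_affine unfolding a by blast
      then show "F (x + real_vec n) = F x + real_vec (B *v n)"
        by (simp add: real_vec_mult matrix_vector_right_distrib)
    qed
  next
    fix C
    assume "\<forall>F. is_lift F (\<lambda>t. torus_mat B t + a) \<longrightarrow>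
              (\<forall>x n. F (x + real_vec n) = F x + real_vec (C *v n))"
    with is_lift_affine[of B a'] have "\<forall>n. real_vec (B *v n) = real_vec (C *v n)"
      unfolding a by (fastforce simp: real_vec_mult matrix_vector_right_distrib)
    then show "C = B"
      by (simp add: matrix_eq)
  qed
qed

lemma affine_action_linear_part:
  assumes "affine_action \<phi>"
  shows "invertible (linear_part (\<phi> l))"
    and "\<exists>a. \<phi> l = (\<lambda>t. torus_mat (linear_part (\<phi> l)) t + a)"
proof -
  obtain B a where B: "invertible B" "\<phi> l = (\<lambda>t. torus_mat B t + a)"
    using assms unfolding affine_action_def Affine_def by blast
  then have *: "linear_part (\<phi> l) = B"
    by (simp only: linear_part_affine)
  show "invertible (linear_part (\<phi> l))"
    unfolding * by (rule B(1))
  show "\<exists>a. \<phi> l = (\<lambda>t. torus_mat (linear_part (\<phi> l)) t + a)"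
    unfolding * using B(2) by blast
qed

lemma torus_mat_add: "torus_mat B (s + t) = torus_mat B s + torus_mat B t"
proof -
  obtain x y where xy: "s = torus_proj x" "t = torus_proj y"
    using torus_proj_surj[of s] torus_proj_surj[of t] by blast
  show ?thesis
    unfolding xy plus_torus.abs_eq torus_mat.abs_eq matrix_vector_right_distrib ..
qed

lemma torus_mat_mult: "torus_mat (B ** C) t = torus_mat B (torus_mat C t)"
proof -
  obtain x where x: "t = torus_proj x"
    using torus_proj_surj by blast
  have "real_mat (B ** C) = real_mat B ** real_mat C"
    by (simp add: vec_eq_iff matrix_matrix_mult_def)
  then show ?thesis
    unfolding x torus_mat.abs_eq by (simp add: matrix_vector_mul_assoc)
qed

lemma linear_part_add:
  assumes "affine_action \<phi>"
  shows "linear_part (\<phi> (l + l')) = linear_part (\<phi> l) ** linear_part (\<phi> l')"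
proof -
  obtain a where a: "\<phi> l = (\<lambda>t. torus_mat (linear_part (\<phi> l)) t + a)"
    using affine_action_linear_part(2)[OF assms] by blast
  obtain a' where a': "\<phi> l' = (\<lambda>t. torus_mat (linear_part (\<phi> l')) t + a')"
    using affine_action_linear_part(2)[OF assms] by blast
  have "\<phi> (l + l') = (\<lambda>t. torus_mat (linear_part (\<phi> l) ** linear_part (\<phi> l')) t +
      (torus_mat (linear_part (\<phi> l)) a' + a))"
  proof
    fix t
    have "\<phi> (l + l') t = \<phi> l (\<phi> l' t)"
      using assms by (simp add: affine_action_def)
    also have "\<dots> = torus_mat (linear_part (\<phi> l)) (\<phi> l' t) + a"
      by (rule fun_cong[OF a])
    also have "\<phi> l' t = torus_mat (linear_part (\<phi> l')) t + a'"
      by (rule fun_cong[OF a'])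
    also have "torus_mat (linear_part (\<phi> l)) \<dots> + a =
        torus_mat (linear_part (\<phi> l) ** linear_part (\<phi> l')) t +
        (torus_mat (linear_part (\<phi> l)) a' + a)"
      by (simp only: torus_mat_add torus_mat_mult add.assoc)
    finally show "\<phi> (l + l') t = \<dots>" .
  qed
  then show ?thesis
    by (simp only: linear_part_affine)
qed


section \<open>The principal affine action\<close>

text \<open>
  The construction depends on the choice of the lifts \<open>\<alpha>\<close> and of \<open>s\<close> and \<open>\<beta>\<close>; the predicate says
  that \<open>\<psi>\<close> is obtained from \<open>\<phi>\<close> by some such choice.
\<close>

definition principal_affine_action ::
    "(int ^ 'p::finite \<Rightarrow> 'q::finite torus \<Rightarrow> 'q torus) \<Rightarrow>
     (int ^ 'p \<Rightarrow> 'q torus \<Rightarrow> 'q torus) \<Rightarrow> bool" where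
  "principal_affine_action \<phi> \<psi> \<longleftrightarrow>
     (\<exists>A \<alpha> k s \<beta> \<alpha>\<^sub>1.
        (\<forall>l. A l = linear_part (\<phi> l)) \<and>
        (\<forall>l. is_lift (\<lambda>x. real_mat (A l) *v x + \<alpha> l) (\<phi> l)) \<and>
        (\<forall>l l'. real_vec (k l l') = \<alpha> l - \<alpha> (l + l') + real_mat (A l) *v \<alpha> l') \<and>
        s \<ge> 1 \<and>
        (\<forall>l l'. int s *s k l l' = \<beta> l - \<beta> (l + l') + A l *v \<beta> l') \<and>
        (\<forall>l. \<alpha>\<^sub>1 l = \<alpha> l - (1 / real s) *\<^sub>R real_vec (\<beta> l)) \<and>
        (\<forall>l x. \<psi> l (torus_proj x) = torus_proj (real_mat (A l) *v x + \<alpha>\<^sub>1 l)))"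

lemma affine_action_principal:
  fixes \<phi> \<psi> :: "int ^ 'p::finite \<Rightarrow> 'q::finite torus \<Rightarrow> 'q torus"
  assumes \<phi>: "affine_action \<phi>" and "principal_affine_action \<phi> \<psi>"
  shows "affine_action \<psi>"
proof -
  obtain A \<alpha> k s \<beta> \<alpha>\<^sub>1 where
    A: "\<And>l. A l = linear_part (\<phi> l)" and
    k: "\<And>l l'. real_vec (k l l') = \<alpha> l - \<alpha> (l + l') + real_mat (A l) *v \<alpha> l'" and
    s: "s \<ge> (1::nat)" and
    \<beta>: "\<And>l l'. int s *s k l l' = \<beta> l - \<beta> (l + l') + A l *v \<beta> l'" and
    \<alpha>\<^sub>1: "\<And>l. \<alpha>\<^sub>1 l = \<alpha> l - (1 / real s) *\<^sub>R real_vec (\<beta> l)" and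
    \<psi>: "\<And>l x. \<psi> l (torus_proj x) = torus_proj (real_mat (A l) *v x + \<alpha>\<^sub>1 l)"
    using assms(2) unfolding principal_affine_action_def by blast
  have cocycle: "\<alpha>\<^sub>1 (l + l') = \<alpha>\<^sub>1 l + real_mat (A l) *v \<alpha>\<^sub>1 l'" for l l'
  proof -
    have "real_vec (int s *s k l l') = real_vec (\<beta> l - \<beta> (l + l') + A l *v \<beta> l')"
      by (rule arg_cong[OF \<beta>])
    moreover have "real_vec (k l l') = (1 / real s) *\<^sub>R real_vec (int s *s k l l')"
      using s by (simp add: vec_eq_iff)
    ultimately have "real_vec (k l l') = (1 / real s) *\<^sub>R
        (real_vec (\<beta> l) - real_vec (\<beta> (l + l')) + real_mat (A l) *v real_vec (\<beta> l'))"
      by (simp only: real_vec_add real_vec_diff real_vec_mult)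
    then have "\<alpha> (l + l') - (1 / real s) *\<^sub>R real_vec (\<beta> (l + l')) =
        \<alpha> l - (1 / real s) *\<^sub>R real_vec (\<beta> l) +
        (real_mat (A l) *v \<alpha> l' - (1 / real s) *\<^sub>R (real_mat (A l) *v real_vec (\<beta> l')))"
      unfolding k scaleR_right_diff_distrib scaleR_right_distrib by (simp add: algebra_simps)
    then show ?thesis
      by (simp only: \<alpha>\<^sub>1 matrix_vector_mult_diff_distrib matrix_vector_mult_scaleR)
  qed
  have \<psi>': "\<psi> l = (\<lambda>t. torus_mat (A l) t + torus_proj (\<alpha>\<^sub>1 l))" for l
  proof
    fix t :: "'q torus"
    obtain x where "t = torus_proj x"
      using torus_proj_surj by blast
    then show "\<psi> l t = torus_mat (A l) t + torus_proj (\<alpha>\<^sub>1 l)"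
      by (simp add: \<psi> torus_mat.abs_eq plus_torus.abs_eq)
  qed
  have "invertible (A l)" for l
    unfolding A by (rule affine_action_linear_part(1)[OF \<phi>])
  moreover have "\<psi> (l + l') = \<psi> l \<circ> \<psi> l'" for l l'
  proof -
    have "torus_proj (\<alpha>\<^sub>1 (l + l')) = torus_mat (A l) (torus_proj (\<alpha>\<^sub>1 l')) + torus_proj (\<alpha>\<^sub>1 l)"
      unfolding cocycle torus_mat.abs_eq plus_torus.abs_eq by (simp only: add.commute)
    moreover have "A (l + l') = A l ** A l'"
      using linear_part_add[OF \<phi>] by (simp add: A)
    ultimately show ?thesis
      by (auto simp: \<psi>' torus_mat_add torus_mat_mult add.assoc)
  qed
  ultimately show ?thesis
    by (auto simp: affine_action_def Affine_def \<psi>')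
qed


section \<open>Dynamical properties\<close>

definition free_action :: "(int ^ 'p::finite \<Rightarrow> 'q::finite torus \<Rightarrow> 'q torus) \<Rightarrow> bool" where
  "free_action \<phi> \<longleftrightarrow> (\<forall>l. l \<noteq> 0 \<longrightarrow> (\<forall>x. \<phi> l x \<noteq> x))"

definition minimal_action :: "(int ^ 'p::finite \<Rightarrow> 'q::finite torus \<Rightarrow> 'q torus) \<Rightarrow> bool" where
  "minimal_action \<phi> \<longleftrightarrow> (\<forall>x. closure (range (\<lambda>l. \<phi> l x)) = UNIV)"

definition smooth_cocycle ::
    "(int ^ 'p::finite \<Rightarrow> 'q::finite torus \<Rightarrow> 'q torus) \<Rightarrow>
     (int ^ 'p \<Rightarrow> 'q torus \<Rightarrow> real) \<Rightarrow> bool" where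
  "smooth_cocycle \<phi> c \<longleftrightarrow>
     (\<forall>l. smooth_on_torus (c l)) \<and> (\<forall>l l' x. c (l + l') x = c l x + c l' (\<phi> l x))"

definition cohomologically_rigid ::
    "(int ^ 'p::finite \<Rightarrow> 'q::finite torus \<Rightarrow> 'q torus) \<Rightarrow> bool" where
  "cohomologically_rigid \<phi> \<longleftrightarrow>
     (\<forall>c. smooth_cocycle \<phi> c \<longrightarrow>
        (\<exists>h f. (\<forall>l l'. h (l + l') = h l + h l') \<and> smooth_on_torus f \<and>
               (\<forall>l x. c l x = h l + f (\<phi> l x) - f x)))"

end

theory Submission
  imports Defs
begin

text \<open>
  The maps \<open>\<phi> l\<close> and \<open>\<psi> l\<close> differ by an \<open>s\<close>-torsion translation.  If \<open>\<psi> l\<close> fixes \<open>x\<close>, the \<open>\<phi>\<close>-orbit of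
  \<open>x\<close> along the multiples of \<open>l\<close> stays in a finite set, so \<open>\<phi>\<close> is not free.  If \<open>\<phi>\<close> is minimal, finitely
  many translates of any \<open>\<psi>\<close>-orbit closure cover the torus, so each orbit closure has interior points;
  its frontier, being closed and \<open>\<psi>\<close>-invariant, is then empty, and the torus is connected.

  For rigidity, expand in Fourier series: with \<open>\<tau> l n = A\<^sup>T n\<close> and the phases \<open>\<theta> l n = e(n \<bullet> \<alpha>\<^sub>1 l)\<close>,
  the action \<open>\<psi>\<close> sends the mode \<open>n\<close> to \<open>\<theta> l n\<close> times the mode \<open>\<tau> l n\<close>, while \<open>\<phi>\<close> on the modes \<open>s n\<close> has
  the phases \<open>\<theta>\<^sup>s\<close>.  A cocycle over \<open>\<psi>\<close> is turned into one over \<open>\<phi>\<close> as follows.  Where \<open>\<theta>\<close> is trivial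
  on the stabilizer of a mode, an invariant of modulus one intertwines \<open>\<theta>\<close> and \<open>\<theta>\<^sup>s\<close>.  Elsewhere the
  cocycle has a canonical formal primitive, and raising the phases of its coefficients to the power \<open>s\<close>
  turns \<open>\<theta>\<close> into \<open>\<theta>\<^sup>s\<close>; this operation is Lipschitz, so the new coboundary still decays rapidly,
  and it preserves moduli, so the decay of its primitive passes back.
\<close>

section \<open>Rigidity on the modes\<close>

definition mode_weight :: "int ^ 'q::finite \<Rightarrow> real" where
  "mode_weight n = 1 + (\<Sum>i\<in>UNIV. \<bar>real_of_int (n $ i)\<bar>)"

text \<open>Rapid decay is smoothness seen on the Fourier side. The leading 1 in
  \<open>mode_weight\<close> keeps every weight at least 1, so larger powers give stronger bounds,
  also at mode 0.\<close>

definition rapid :: "(int ^ 'q::finite \<Rightarrow> complex) \<Rightarrow> bool" where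
  "rapid a \<longleftrightarrow> (\<forall>k. \<exists>C. \<forall>n. cmod (a n) * mode_weight n ^ k \<le> C)"

lemma mode_weight_ge_1: "1 \<le> mode_weight n"
  unfolding mode_weight_def by (simp add: sum_nonneg)

lemma abs_nth_le_mode_weight: "\<bar>real_of_int (n $ i)\<bar> \<le> mode_weight n"
proof -
  have "\<bar>real_of_int (n $ i)\<bar> \<le> (\<Sum>i\<in>UNIV. \<bar>real_of_int (n $ i)\<bar>)"
    by (rule member_le_sum) auto
  then show ?thesis
    by (simp add: mode_weight_def)
qed

lemma finite_bounded_vec: "finite {n :: int ^ 'q::finite. \<forall>i. \<bar>n $ i\<bar> \<le> k}"
proof -
  have "finite (PiE (UNIV :: 'q set) (\<lambda>i. {-k..k}))"
    by (rule finite_PiE) auto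
  then have "finite ((\<lambda>f. \<chi> i. f i) ` (PiE (UNIV :: 'q set) (\<lambda>i. {-k..k})))"
    by (rule finite_imageI)
  moreover have "{n :: int ^ 'q. \<forall>i. \<bar>n $ i\<bar> \<le> k} \<subseteq>
      (\<lambda>f. \<chi> i. f i) ` (PiE (UNIV :: 'q set) (\<lambda>i. {-k..k}))"
  proof
    fix n :: "int ^ 'q"
    assume "n \<in> {n. \<forall>i. \<bar>n $ i\<bar> \<le> k}"
    then have "vec_nth n \<in> PiE UNIV (\<lambda>i. {-k..k})"
      by (auto simp: abs_le_iff minus_le_iff)
    then show "n \<in> (\<lambda>f. \<chi> i. f i) ` (PiE (UNIV :: 'q set) (\<lambda>i. {-k..k}))"
      by (intro image_eqI[of _ _ "vec_nth n"]) (simp_all add: vec_eq_iff)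
  qed
  ultimately show ?thesis
    by (rule rev_finite_subset)
qed

lemma finite_mode_weight_le: "finite {n :: int ^ 'q::finite. mode_weight n \<le> K}"
proof (rule finite_subset)
  show "{n :: int ^ 'q. mode_weight n \<le> K} \<subseteq> {n. \<forall>i. \<bar>n $ i\<bar> \<le> \<lfloor>K\<rfloor>}"
  proof clarify
    fix n :: "int ^ 'q" and i assume "mode_weight n \<le> K"
    with abs_nth_le_mode_weight[of n i] have "real_of_int \<bar>n $ i\<bar> \<le> K"
      by simp
    then show "\<bar>n $ i\<bar> \<le> \<lfloor>K\<rfloor>"
      by linarith
  qed
qed (rule finite_bounded_vec)

lemma rapid_le:
  assumes "rapid a" and le: "\<And>n. cmod (b n) \<le> K * cmod (a n)"
  shows "rapid b"
  unfolding rapid_def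
proof
  fix k
  obtain C where C: "\<And>n. cmod (a n) * mode_weight n ^ k \<le> C"
    using assms(1) unfolding rapid_def by blast
  have "cmod (b n) * mode_weight n ^ k \<le> \<bar>K\<bar> * C" for n
  proof -
    have w: "0 \<le> mode_weight n ^ k"
      using mode_weight_ge_1[of n] by simp
    have "cmod (b n) \<le> \<bar>K\<bar> * cmod (a n)"
      using le[of n] by (smt (verit) mult_right_mono norm_ge_zero)
    then have "cmod (b n) * mode_weight n ^ k \<le> \<bar>K\<bar> * (cmod (a n) * mode_weight n ^ k)"
      using w by (simp add: mult_right_mono flip: mult.assoc)
    also have "\<dots> \<le> \<bar>K\<bar> * C"
      by (rule mult_left_mono[OF C]) simp
    finally show ?thesis .
  qed
  then show "\<exists>C. \<forall>n. cmod (b n) * mode_weight n ^ k \<le> C"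
    by blast
qed

lemma rapid_add:
  assumes "rapid a" "rapid b"
  shows "rapid (\<lambda>n. a n + b n)"
  unfolding rapid_def
proof
  fix k
  obtain C D where C: "\<And>n. cmod (a n) * mode_weight n ^ k \<le> C"
    and D: "\<And>n. cmod (b n) * mode_weight n ^ k \<le> D"
    using assms unfolding rapid_def by metis
  have "cmod (a n + b n) * mode_weight n ^ k \<le> C + D" for n
  proof -
    have "cmod (a n + b n) * mode_weight n ^ k \<le> (cmod (a n) + cmod (b n)) * mode_weight n ^ k"
      using mode_weight_ge_1[of n] by (intro mult_right_mono norm_triangle_ineq) simp
    then show ?thesis
      using C[of n] D[of n] by (simp add: distrib_right)
  qed
  then show "\<exists>C. \<forall>n. cmod (a n + b n) * mode_weight n ^ k \<le> C"
    by blast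
qed

lemma rapid_finite_support:
  assumes "finite {n. a n \<noteq> 0}"
  shows "rapid a"
  unfolding rapid_def
proof
  fix k
  let ?S = "{n. a n \<noteq> 0}"
  have "cmod (a n) * mode_weight n ^ k \<le> (\<Sum>m\<in>?S. cmod (a m) * mode_weight m ^ k)" for n
  proof (cases "a n = 0")
    case True
    then show ?thesis
      using mode_weight_ge_1 by (auto intro!: sum_nonneg mult_nonneg_nonneg zero_le_power
          intro: order_trans[OF zero_le_one])
  next
    case False
    then show ?thesis
      using assms mode_weight_ge_1
      by (intro member_le_sum[where f = "\<lambda>m. cmod (a m) * mode_weight m ^ k"])
        (auto intro!: mult_nonneg_nonneg zero_le_power intro: order_trans[OF zero_le_one])
  qed
  then show "\<exists>C. \<forall>n. cmod (a n) * mode_weight n ^ k \<le> C"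
    by blast
qed

text \<open>The first power of the weight suffices: a lower bound \<open>e\<close> on the modulus
  confines \<open>n\<close> to weights at most \<open>C / e\<close>. A rapid sequence therefore
  cannot stay away from zero on an infinite set of modes.\<close>

lemma finite_rapid_ge:
  assumes "rapid a" "0 < e"
  shows "finite {n \<in> X. e \<le> cmod (a n)}"
proof -
  obtain C where C: "\<And>n. cmod (a n) * mode_weight n ^ 1 \<le> C"
    using assms(1) unfolding rapid_def by blast
  have "{n \<in> X. e \<le> cmod (a n)} \<subseteq> {n. mode_weight n \<le> C / e}"
  proof clarify
    fix n assume "e \<le> cmod (a n)"
    then have "e * mode_weight n \<le> cmod (a n) * mode_weight n"
      using mode_weight_ge_1[of n] by (intro mult_right_mono) auto
    with C[of n] show "mode_weight n \<le> C / e"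
      using \<open>0 < e\<close> by (simp add: field_simps)
  qed
  then show ?thesis
    using finite_mode_weight_le finite_subset by blast
qed

text \<open>Unlike the plain power \<open>w ^ s\<close>, this map is homogeneous of degree one in
  the modulus, so it is globally Lipschitz and carries decay over in both directions.\<close>

definition phase_power :: "nat \<Rightarrow> complex \<Rightarrow> complex" where
  "phase_power s w = of_real (cmod w) * sgn w ^ s"

lemma norm_phase_power: "cmod (phase_power s w) = cmod w"
  by (cases "w = 0") (simp_all add: phase_power_def norm_mult norm_power norm_sgn)

text \<open>This equivariance turns coboundaries for \<theta> into coboundaries for
  \<open>\<theta> ^ s\<close>.\<close>

lemma phase_power_mult: "cmod z = 1 \<Longrightarrow> phase_power s (z * w) = z ^ s * phase_power s w"
  using sgn_eq[of z] by (simp add: phase_power_def norm_mult sgn_mult power_mult_distrib)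

text \<open>Modulus and phase are varied separately. The change of modulus is at most
  \<open>cmod (w - v)\<close>; the powers of the phases differ by at most \<open>s\<close> times the
  difference of the phases, which the factor \<open>cmod v\<close> reduces to at most
  \<open>2 * cmod (w - v)\<close>.\<close>

lemma phase_power_lipschitz:
  "cmod (phase_power s w - phase_power s v) \<le> (1 + 2 * real s) * cmod (w - v)"
proof (cases "w = 0 \<or> v = 0")
  case True
  then have "cmod (phase_power s w - phase_power s v) = cmod (w - v)"
    using norm_phase_power[of s] by (auto simp: phase_power_def[of s 0])
  also have "\<dots> \<le> (1 + 2 * real s) * cmod (w - v)"
    by (simp add: algebra_simps)
  finally show ?thesis .
next
  case False
  then have sw: "cmod (sgn w) = 1" and sv: "cmod (sgn v) = 1"
    by (simp_all add: norm_sgn)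
  have w: "of_real (cmod w) * sgn w = w" and v: "of_real (cmod v) * sgn v = v"
    using False by (simp_all add: sgn_eq)
  have d: "\<bar>cmod w - cmod v\<bar> \<le> cmod (w - v)"
    by (rule norm_triangle_ineq3)
  have "phase_power s w - phase_power s v =
      of_real (cmod w - cmod v) * sgn w ^ s + of_real (cmod v) * (sgn w ^ s - sgn v ^ s)"
    by (simp add: phase_power_def algebra_simps)
  then have 1: "cmod (phase_power s w - phase_power s v) \<le>
      \<bar>cmod w - cmod v\<bar> + cmod v * cmod (sgn w ^ s - sgn v ^ s)"
    using norm_triangle_ineq[of "of_real (cmod w - cmod v) * sgn w ^ s"
        "of_real (cmod v) * (sgn w ^ s - sgn v ^ s)"] sw
    by (simp add: norm_mult norm_power del: of_real_diff)
  have "cmod (sgn w ^ s - sgn v ^ s) \<le> s * cmod (sgn w - sgn v)"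
    by (rule norm_power_diff) (simp_all add: sw sv)
  then have 2: "cmod v * cmod (sgn w ^ s - sgn v ^ s) \<le>
      s * cmod (of_real (cmod v) * (sgn w - sgn v))"
    using mult_left_mono[of _ _ "cmod v"] by (fastforce simp: norm_mult mult_ac)
  \<comment> \<open>Replacing \<open>cmod v\<close> by \<open>cmod w\<close> in front of
    \<open>sgn w\<close> costs one more \<open>cmod (w - v)\<close>, which is the source of the
    factor 2.\<close>
  have "of_real (cmod v) * (sgn w - sgn v) = - of_real (cmod w - cmod v) * sgn w + (w - v)"
    using w v by (simp add: algebra_simps)
  then have "cmod (of_real (cmod v) * (sgn w - sgn v)) \<le> \<bar>cmod w - cmod v\<bar> + cmod (w - v)"
    using norm_triangle_ineq[of "- of_real (cmod w - cmod v) * sgn w" "w - v"] sw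
    by (simp add: norm_mult del: of_real_diff)
  with d have "cmod (of_real (cmod v) * (sgn w - sgn v)) \<le> 2 * cmod (w - v)"
    by linarith
  then have "s * cmod (of_real (cmod v) * (sgn w - sgn v)) \<le> s * (2 * cmod (w - v))"
    by (rule mult_left_mono) simp
  then show ?thesis
    using 1 2 d by (simp add: algebra_simps)
qed

text \<open>The cocycle identity for functions is compared at the mode \<open>\<tau> l n\<close>:
  composition with the action carries the coefficient of mode \<open>n\<close> there and multiplies
  it by \<open>\<theta> l n\<close>.\<close>

definition mode_cocycle ::
    "(int ^ 'p::finite \<Rightarrow> int ^ 'q::finite \<Rightarrow> int ^ 'q) \<Rightarrow> (int ^ 'p \<Rightarrow> int ^ 'q \<Rightarrow> complex) \<Rightarrow>
     (int ^ 'p \<Rightarrow> int ^ 'q \<Rightarrow> complex) \<Rightarrow> bool" where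
  "mode_cocycle \<tau> \<theta> c \<longleftrightarrow>
     (\<forall>l. rapid (c l)) \<and> (\<forall>l l' n. c (l + l') (\<tau> l n) = c l (\<tau> l n) + \<theta> l n * c l' n)"

text \<open>Mode 0 is exempt because it carries the constants, that is, the homomorphism to which a
  cocycle may be cohomologous.\<close>

definition mode_rigid ::
    "(int ^ 'p::finite \<Rightarrow> int ^ 'q::finite \<Rightarrow> int ^ 'q) \<Rightarrow> (int ^ 'p \<Rightarrow> int ^ 'q \<Rightarrow> complex) \<Rightarrow> bool"
  where
  "mode_rigid \<tau> \<theta> \<longleftrightarrow>
     (\<forall>c. mode_cocycle \<tau> \<theta> c \<longrightarrow>
       (\<exists>f. rapid f \<and> (\<forall>l n. n \<noteq> 0 \<longrightarrow> c l (\<tau> l n) = \<theta> l n * f n - f (\<tau> l n))))"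

lemma mode_rigidE:
  assumes "mode_rigid \<tau> \<theta>" "mode_cocycle \<tau> \<theta> c"
  obtains f where "rapid f" "\<And>l n. n \<noteq> 0 \<Longrightarrow> c l (\<tau> l n) = \<theta> l n * f n - f (\<tau> l n)"
  using assms unfolding mode_rigid_def by metis

section \<open>Orbits of modes and phases on their stabilizers\<close>

locale mode_action =
  fixes \<tau> :: "int ^ 'p::finite \<Rightarrow> int ^ 'q::finite \<Rightarrow> int ^ 'q"
    and \<theta> :: "int ^ 'p \<Rightarrow> int ^ 'q \<Rightarrow> complex"
  assumes \<tau>_0: "\<tau> 0 n = n"
    and \<tau>_add: "\<tau> (l + l') n = \<tau> l' (\<tau> l n)"
    and \<tau>_zero: "\<tau> l 0 = 0"
    and \<theta>_unit: "cmod (\<theta> l n) = 1"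
    and \<theta>_zero: "\<theta> l 0 = 1"
    and \<theta>_add: "\<theta> (l + l') n = \<theta> l n * \<theta> l' (\<tau> l n)"
begin

lemma \<theta>_nz: "\<theta> l n \<noteq> 0"
  using \<theta>_unit[of l n] by auto

lemma \<tau>_commute: "\<tau> l (\<tau> l' n) = \<tau> l' (\<tau> l n)"
  by (metis \<tau>_add add.commute)

lemma \<tau>_cancel: "\<tau> (- l) (\<tau> l n) = n" "\<tau> l (\<tau> (- l) n) = n"
  by (metis \<tau>_0 \<tau>_add add.right_inverse, metis \<tau>_0 \<tau>_add add.left_inverse)

lemma \<tau>_eq_zero_iff: "\<tau> l n = 0 \<longleftrightarrow> n = 0"
  by (metis \<tau>_cancel(1) \<tau>_zero)

definition orbit :: "int ^ 'q \<Rightarrow> (int ^ 'q) set" where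
  "orbit n = range (\<lambda>l. \<tau> l n)"

lemma orbit_\<tau>: "orbit (\<tau> l n) = orbit n"
proof -
  have "\<tau> l' (\<tau> l n) \<in> orbit n" "\<tau> l' n \<in> orbit (\<tau> l n)" for l'
    unfolding orbit_def
    by (metis \<tau>_add rangeI, metis \<tau>_add \<tau>_cancel(1) rangeI)
  then show ?thesis
    by (auto simp: orbit_def)
qed

lemma self_in_orbit: "n \<in> orbit n"
  unfolding orbit_def by (metis \<tau>_0 rangeI)

lemma mem_orbit_iff: "m \<in> orbit n \<longleftrightarrow> orbit m = orbit n"
  using orbit_\<tau> self_in_orbit by (auto simp: orbit_def[of n])

lemma stab_\<tau>: "\<tau> l (\<tau> m n) = \<tau> m n \<longleftrightarrow> \<tau> l n = n"
  by (metis \<tau>_cancel(1) \<tau>_commute)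

text \<open>Expanding the phase of \<open>l + m\<close> at \<open>n\<close> in both orders and
  cancelling \<open>\<theta> m n\<close> shows that the phase of a stabilizing element is constant
  along the orbit; this uses that the acting group is commutative.\<close>

lemma \<theta>_stab: "\<tau> l n = n \<Longrightarrow> \<theta> l (\<tau> m n) = \<theta> l n"
  using \<theta>_add[of m l n] \<theta>_add[of l m n] \<theta>_nz[of m n] by (simp add: add.commute)

text \<open>Triviality on the stabilizer is the condition for \<theta> to be a multiplicative
  coboundary on the orbit of \<open>n\<close>.\<close>

definition unobstructed :: "int ^ 'q \<Rightarrow> bool" where
  "unobstructed n \<longleftrightarrow> (\<forall>l. \<tau> l n = n \<longrightarrow> \<theta> l n = 1)"

lemma unobstructed_\<tau>: "unobstructed (\<tau> l n) \<longleftrightarrow> unobstructed n"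
  unfolding unobstructed_def using \<theta>_stab stab_\<tau> by metis

text \<open>Fix a representative \<open>r n\<close> of each orbit and an element \<open>t n\<close>
  taking it to \<open>n\<close>, and let the invariant at \<open>n\<close> be the phase collected on
  the way. Two ways from \<open>r n\<close> to the same mode differ by a stabilizing element, whose
  phase is 1.\<close>

lemma ex_invariant:
  "\<exists>g. \<forall>n. unobstructed n \<longrightarrow> cmod (g n) = 1 \<and> (\<forall>l. g (\<tau> l n) = \<theta> l n * g n)"
proof -
  define r where "r n = (SOME m. m \<in> orbit n)" for n
  define t where "t n = (SOME l. \<tau> l (r n) = n)" for n
  have r: "r (\<tau> l n) = r n" for l n
    by (simp add: r_def orbit_\<tau>)
  have "r n \<in> orbit n" for n
    unfolding r_def using self_in_orbit by (rule someI)
  then have "\<exists>l. \<tau> l (r n) = n" for n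
    unfolding orbit_def by (metis (mono_tags) \<tau>_cancel(1) rangeE)
  then have t: "\<tau> (t n) (r n) = n" for n
    unfolding t_def by (rule someI_ex)
  have "\<theta> (t (\<tau> l n)) (r n) = \<theta> l n * \<theta> (t n) (r n)" if "unobstructed n" for l n
  proof -
    \<comment> \<open>This element leads from \<open>r n\<close> to \<open>n\<close>, on to
      \<open>\<tau> l n\<close> and back to \<open>r n\<close>.\<close>
    let ?d = "t n + l - t (\<tau> l n)"
    have "\<tau> (t (\<tau> l n)) (r n) = \<tau> l n"
      using t[of "\<tau> l n"] by (simp add: r)
    moreover have "\<tau> (t n + l) (r n) = \<tau> l n"
      by (simp add: \<tau>_add t)
    ultimately have *: "\<tau> (t n + l) (r n) = \<tau> (t (\<tau> l n)) (r n)"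
      by simp
    have "\<tau> ?d (r n) = \<tau> (- t (\<tau> l n)) (\<tau> (t n + l) (r n))"
      by (simp flip: \<tau>_add)
    also have "\<dots> = r n"
      by (simp only: * \<tau>_cancel)
    finally have d: "\<tau> ?d (r n) = r n" .
    moreover have "unobstructed (r n)"
      using that t[of n] unobstructed_\<tau> by metis
    ultimately have "\<theta> ?d (r n) = 1"
      by (simp add: unobstructed_def)
    then have "\<theta> (t n + l) (r n) = \<theta> (t (\<tau> l n)) (r n)"
      using \<theta>_add[of ?d "t (\<tau> l n)" "r n"] d by simp
    then show ?thesis
      using \<theta>_add[of "t n" l "r n"] t[of n] by (simp add: mult.commute)
  qed
  then show ?thesis
    by (intro exI[of _ "\<lambda>n. \<theta> (t n) (r n)"]) (simp add: \<theta>_unit r)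
qed

section \<open>Rigidity for a power of the phases\<close>

lemma mode_action_power: "mode_action \<tau> (\<lambda>l n. \<theta> l n ^ s)"
  by unfold_locales
    (simp_all add: \<tau>_0 \<tau>_add \<tau>_zero \<theta>_unit \<theta>_zero \<theta>_add norm_power power_mult_distrib)

text \<open>An invariant function with finite spectrum, multiplied by a homomorphism into the reals, would
  be a cocycle with unbounded primitive.\<close>

lemma finite_orbit_obstructed:
  assumes "mode_rigid \<tau> \<theta>" "finite (orbit n)" "n \<noteq> 0"
  shows "\<not> unobstructed n"
proof
  assume n: "unobstructed n"
  obtain g where g: "\<And>n. unobstructed n \<Longrightarrow> cmod (g n) = 1"
    "\<And>n l. unobstructed n \<Longrightarrow> g (\<tau> l n) = \<theta> l n * g n"
    using ex_invariant by blast
  \<comment> \<open>Any coordinate of the acting group will do; \<open>l $ i\<close> is the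
    homomorphism that multiplies the invariant.\<close>
  define i :: 'p where "i = undefined"
  define c where "c l m = (if m \<in> orbit n then of_int (l $ i) * g m else 0)" for l m
  have orb: "\<tau> l m \<in> orbit n \<longleftrightarrow> m \<in> orbit n" for l m
    by (simp add: mem_orbit_iff orbit_\<tau>)
  have un: "unobstructed m" if "m \<in> orbit n" for m
    using that n unobstructed_\<tau> by (auto simp: orbit_def)
  have "rapid (c l)" for l
    by (rule rapid_finite_support, rule finite_subset[OF _ assms(2)]) (auto simp: c_def)
  moreover have "c (l + l') (\<tau> l m) = c l (\<tau> l m) + \<theta> l m * c l' m" for l l' m
    using g(2)[OF un, of m l] by (simp add: c_def orb algebra_simps)
  ultimately have "mode_cocycle \<tau> \<theta> c"
    by (simp add: mode_cocycle_def)
  from mode_rigidE[OF assms(1) this]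
  obtain f where f: "\<And>l m. m \<noteq> 0 \<Longrightarrow> c l (\<tau> l m) = \<theta> l m * f m - f (\<tau> l m)"
    by metis
  \<comment> \<open>A finite orbit repeats along the multiples of one basis vector, and two
    multiples with the same image differ by a nonzero element of the stabilizer.\<close>
  have "finite (range (\<lambda>k::nat. \<tau> (of_nat k *s axis i 1) n))"
    by (rule finite_subset[OF _ assms(2)]) (auto simp: orbit_def)
  then obtain j k :: nat where jk: "j \<noteq> k"
      "\<tau> (of_nat j *s axis i 1) n = \<tau> (of_nat k *s axis i 1) n"
    using finite_imageD[of "\<lambda>k::nat. \<tau> (of_nat k *s axis i 1) n" UNIV]
    by (auto simp: inj_on_def)
  let ?l = "of_nat j *s axis i 1 - of_nat k *s axis i (1::int)"
  have "\<tau> ?l n = \<tau> (- (of_nat k *s axis i 1)) (\<tau> (of_nat j *s axis i 1) n)"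
    by (simp flip: \<tau>_add)
  then have l: "\<tau> ?l n = n"
    unfolding jk(2) \<tau>_cancel .
  \<comment> \<open>On a stabilizing element the coboundary is \<open>f n - f n\<close>, whereas
    \<open>c\<close> takes a nonzero integer multiple of \<open>g n\<close> there.\<close>
  then have "c ?l n = 0"
    using f[OF \<open>n \<noteq> 0\<close>, of ?l] n by (simp add: unobstructed_def)
  moreover note self_in_orbit[of n]
  moreover have "g n \<noteq> 0"
    using g(1)[OF n] by auto
  ultimately show False
    using jk(1) by (simp add: c_def)
qed

text \<open>The cocycle identity for \<open>l + k = k + l\<close> at the mode
  \<open>\<tau> l n\<close>, written in both orders, determines \<open>c l (\<tau> l n)\<close> up
  to the factor \<open>\<theta> k n - 1\<close>, by which one may divide.\<close>

lemma obstructed_primitive: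
  assumes "mode_cocycle \<tau> \<theta> c" "\<tau> k n = n" "\<theta> k n \<noteq> 1"
  shows "c l (\<tau> l n) = \<theta> l n * (c k n / (\<theta> k n - 1)) - c k (\<tau> l n) / (\<theta> k n - 1)"
proof -
  have m: "\<tau> k (\<tau> l n) = \<tau> l n" "\<theta> k (\<tau> l n) = \<theta> k n"
    using assms stab_\<tau> \<theta>_stab by auto
  have "c (l + k) (\<tau> l n) = c l (\<tau> l n) + \<theta> l n * c k n"
    using assms by (simp add: mode_cocycle_def)
  moreover have "c (k + l) (\<tau> k (\<tau> l n)) = c k (\<tau> k (\<tau> l n)) + \<theta> k (\<tau> l n) * c l (\<tau> l n)"
    using assms unfolding mode_cocycle_def by blast
  ultimately have "(\<theta> k n - 1) * c l (\<tau> l n) = \<theta> l n * c k n - c k (\<tau> l n)"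
    by (simp add: m add.commute algebra_simps)
  then have "c l (\<tau> l n) = (\<theta> l n * c k n - c k (\<tau> l n)) / (\<theta> k n - 1)"
    using assms(3) by (simp add: eq_divide_eq mult.commute)
  then show ?thesis
    by (simp add: diff_divide_distrib)
qed

text \<open>The rigidity for \<open>\<theta>\<^sup>s\<close> also excludes finite nonzero orbits on which \<open>\<theta>\<^sup>s\<close> is trivial on the
  stabilizer; on the other obstructed orbits the difference \<open>D\<close> of the two primitives vanishes, because
  its modulus is constant along the orbit and, if the orbit is infinite, also tends to \<open>0\<close>.\<close>

theorem mode_rigid_of_power:
  assumes rigid: "mode_rigid \<tau> (\<lambda>l n. \<theta> l n ^ s)" and "s \<ge> 1"
  shows "mode_rigid \<tau> \<theta>"
  unfolding mode_rigid_def
proof (intro allI impI)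
  fix c assume c: "mode_cocycle \<tau> \<theta> c"
  interpret P: mode_action \<tau> "\<lambda>l n. \<theta> l n ^ s"
    by (rule mode_action_power)
  obtain g where g: "\<And>n. unobstructed n \<Longrightarrow> cmod (g n) = 1"
    "\<And>n l. unobstructed n \<Longrightarrow> g (\<tau> l n) = \<theta> l n * g n"
    using ex_invariant by blast
  define K where "K n = (SOME k. \<tau> k n = n \<and> \<theta> k n \<noteq> 1)" for n
  have K: "\<tau> (K n) n = n" "\<theta> (K n) n \<noteq> 1" if "\<not> unobstructed n" for n
    using someI_ex[of "\<lambda>k. \<tau> k n = n \<and> \<theta> k n \<noteq> 1"] that
    unfolding K_def unobstructed_def by auto
  \<comment> \<open>Both conditions on \<open>k\<close> are the same for all modes of an orbit, so
    the choice is constant on orbits and one divisor serves each orbit.\<close>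
  have K_\<tau>: "K (\<tau> l n) = K n" for l n
  proof -
    have "(\<lambda>k. \<tau> k (\<tau> l n) = \<tau> l n \<and> \<theta> k (\<tau> l n) \<noteq> 1) = (\<lambda>k. \<tau> k n = n \<and> \<theta> k n \<noteq> 1)"
      using stab_\<tau> \<theta>_stab by metis
    then show ?thesis
      by (simp add: K_def)
  qed
  \<comment> \<open>No lower bound on the divisors over all orbits is at hand, so the decay of
    \<open>f\<close> is not clear yet; it comes later from \<open>f'\<close>.\<close>
  define f where "f n = c (K n) n / (\<theta> (K n) n - 1)" for n
  have f: "c l (\<tau> l n) = \<theta> l n * f n - f (\<tau> l n)" if "\<not> unobstructed n" for l n
    using obstructed_primitive[OF c K[OF that], of l] \<theta>_stab[OF K(1)[OF that], of l]
    by (simp add: f_def K_\<tau>)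
  \<comment> \<open>The factor \<open>g m ^ (s - 1)\<close> supplies the missing
    \<open>s - 1\<close> powers of the phase. In the other case the transported value stays inside
    \<open>phase_power\<close>, so that the Lipschitz bound applies to the difference.\<close>
  define c' where "c' l m = (if unobstructed m then g m ^ (s - 1) * c l m else
      phase_power s (\<theta> l (\<tau> (- l) m) * f (\<tau> (- l) m)) - phase_power s (f m))" for l m
  have c'_un: "c' l m = g m ^ (s - 1) * c l m" if "unobstructed m" for l m
    using that by (simp add: c'_def)
  have c'_ob: "c' l (\<tau> l n) = \<theta> l n ^ s * phase_power s (f n) - phase_power s (f (\<tau> l n))"
    if "\<not> unobstructed n" for l n
    using that by (simp add: c'_def unobstructed_\<tau> \<tau>_cancel phase_power_mult \<theta>_unit)
  have c'_le: "cmod (c' l m) \<le> (1 + 2 * real s) * cmod (c l m)" for l m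
  proof (cases "unobstructed m")
    case True
    then show ?thesis
      by (simp add: c'_un norm_mult norm_power g(1) distrib_right)
  next
    case False
    then have "\<not> unobstructed (\<tau> (- l) m)"
      by (simp add: unobstructed_\<tau>)
    from f[OF this, of l]
    have "c l m = \<theta> l (\<tau> (- l) m) * f (\<tau> (- l) m) - f m"
      by (simp add: \<tau>_cancel)
    then show ?thesis
      using False phase_power_lipschitz by (simp add: c'_def)
  qed
  have pow: "\<theta> l n ^ s = \<theta> l n ^ (s - 1) * \<theta> l n" for l n
    using \<open>s \<ge> 1\<close> by (metis power_minus_mult zero_less_iff_neq_zero not_one_le_zero)
  have "mode_cocycle \<tau> (\<lambda>l n. \<theta> l n ^ s) c'"
    unfolding mode_cocycle_def
  proof (intro conjI allI)
    show "rapid (c' l)" for l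
      using c c'_le rapid_le unfolding mode_cocycle_def by blast
  next
    fix l l' n
    show "c' (l + l') (\<tau> l n) = c' l (\<tau> l n) + \<theta> l n ^ s * c' l' n"
    proof (cases "unobstructed n")
      case True
      have "c (l + l') (\<tau> l n) = c l (\<tau> l n) + \<theta> l n * c l' n"
        using c by (simp add: mode_cocycle_def)
      then show ?thesis
        using True by (simp add: c'_un unobstructed_\<tau> g(2) pow power_mult_distrib algebra_simps)
    next
      case False
      \<comment> \<open>Starting from \<open>m\<close>, the values of \<open>c'\<close> involved are
        differences of one sequence up to phases, and they telescope.\<close>
      define m where "m = \<tau> (- l') n"
      have n: "n = \<tau> l' m" and m: "\<not> unobstructed m"
        using False by (simp_all add: m_def \<tau>_cancel unobstructed_\<tau>)
      have "\<theta> (l + l') m = \<theta> l' m * \<theta> l n"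
        using \<theta>_add[of l' l m] by (simp add: n add.commute)
      moreover have "\<tau> (l + l') m = \<tau> l n"
        by (metis \<tau>_add \<tau>_commute n)
      ultimately have "c' (l + l') (\<tau> l n) =
          (\<theta> l' m * \<theta> l n) ^ s * phase_power s (f m) - phase_power s (f (\<tau> l n))"
        using c'_ob[OF m, of "l + l'"] by simp
      moreover have "c' l' n = \<theta> l' m ^ s * phase_power s (f m) - phase_power s (f n)"
        using c'_ob[OF m, of l'] by (simp flip: n)
      ultimately show ?thesis
        by (simp add: c'_ob[OF False] power_mult_distrib ring_distribs mult_ac)
    qed
  qed
  from mode_rigidE[OF rigid this] obtain f' where f': "rapid f'"
    "\<And>l n. n \<noteq> 0 \<Longrightarrow> c' l (\<tau> l n) = \<theta> l n ^ s * f' n - f' (\<tau> l n)"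
    by metis
  have f_eq: "phase_power s (f n) = f' n" if "\<not> unobstructed n" "n \<noteq> 0" for n
  proof -
    define D where "D m = phase_power s (f m) - f' m" for m
    have D: "D (\<tau> l n) = \<theta> l n ^ s * D n" for l
      using c'_ob[OF that(1), of l] f'(2)[OF that(2), of l] by (simp add: D_def algebra_simps)
    have "D n = 0"
    proof (cases "finite (orbit n)")
      case True
      \<comment> \<open>Some stabilizing element has an \<open>s\<close>-th power of its phase
        different from 1; by the equivariance of \<open>D\<close> this number times
        \<open>D n\<close> is again \<open>D n\<close>.\<close>
      then have "\<not> P.unobstructed n"
        using P.finite_orbit_obstructed[OF rigid, of n] that by (simp add: P.orbit_def orbit_def)
      then show ?thesis
        using D unfolding P.unobstructed_def by (metis mult_cancel_right1)
    next
      case False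
      show ?thesis
      proof (rule ccontr)
        assume "D n \<noteq> 0"
        \<comment> \<open>\<open>a\<close> agrees with \<open>f\<close> on the orbit of
          \<open>n\<close>, but its divisor is one constant, so it inherits the decay of
          \<open>c (K n)\<close>.\<close>
        define a where "a m = c (K n) m / (\<theta> (K n) n - 1)" for m
        have "rapid (c (K n))"
          using c by (simp add: mode_cocycle_def)
        then have a: "rapid a"
          by (rule rapid_le[where K = "1 / cmod (\<theta> (K n) n - 1)"]) (simp add: a_def norm_divide)
        \<comment> \<open>If two moduli sum to at least \<open>cmod (D n)\<close>, one of them is at
          least half of it; so the orbit is covered by two finite sets.\<close>
        let ?e = "cmod (D n) / 2"
        have "orbit n \<subseteq> {m \<in> orbit n. ?e \<le> cmod (a m)} \<union> {m \<in> orbit n. ?e \<le> cmod (f' m)}"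
        proof
          fix m assume "m \<in> orbit n"
          then obtain l where m: "m = \<tau> l n"
            by (auto simp: orbit_def)
          have "f m = a m"
            using \<theta>_stab[OF K(1)[OF that(1)], of l] by (simp add: m f_def a_def K_\<tau>)
          then have "cmod (D m) \<le> cmod (a m) + cmod (f' m)"
            unfolding D_def by (metis norm_triangle_ineq4 norm_phase_power)
          moreover have "cmod (D m) = cmod (D n)"
            by (simp add: m D norm_mult norm_power \<theta>_unit)
          ultimately show "m \<in> {m \<in> orbit n. ?e \<le> cmod (a m)} \<union> {m \<in> orbit n. ?e \<le> cmod (f' m)}"
            using \<open>m \<in> orbit n\<close> by auto
        qed
        moreover have "0 < ?e"
          using \<open>D n \<noteq> 0\<close> by simp
        ultimately show False
          using finite_rapid_ge[OF a] finite_rapid_ge[OF f'(1)] False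
          by (meson finite_UnI finite_subset)
      qed
    qed
    then show ?thesis
      by (simp add: D_def)
  qed
  define F where "F n = (if unobstructed n then f' n / g n ^ (s - 1) else f n)" for n
  have "c l (\<tau> l n) = \<theta> l n * F n - F (\<tau> l n)" if "n \<noteq> 0" for l n
  proof (cases "unobstructed n")
    case True
    have "g n \<noteq> 0"
      using g(1)[OF True] by auto
    moreover have "g (\<tau> l n) ^ (s - 1) * c l (\<tau> l n) = \<theta> l n ^ s * f' n - f' (\<tau> l n)"
      using f'(2)[OF that, of l] True by (simp add: c'_un unobstructed_\<tau>)
    ultimately show ?thesis
      using True \<theta>_nz[of l n]
      by (simp add: F_def unobstructed_\<tau> g(2) pow power_mult_distrib field_simps)
  next
    case False
    then show ?thesis
      by (simp add: F_def f unobstructed_\<tau>)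
  qed
  moreover have "rapid F"
  proof -
    \<comment> \<open>Mode 0 is on the unobstructed side, so \<open>f_eq\<close>, stated for nonzero
      modes, covers every obstructed mode.\<close>
    have 0: "unobstructed 0"
      by (simp add: unobstructed_def \<theta>_zero)
    have "cmod (F n) \<le> 1 * cmod (f' n)" for n
    proof (cases "unobstructed n")
      case True
      then show ?thesis
        by (simp add: F_def norm_divide norm_power g(1))
    next
      case False
      with 0 have "n \<noteq> 0"
        by metis
      then show ?thesis
        using False norm_phase_power[of s "f n"] by (simp add: F_def f_eq)
    qed
    then show ?thesis
      by (rule rapid_le[OF f'(1)])
  qed
  ultimately show "\<exists>f. rapid f \<and> (\<forall>l n. n \<noteq> 0 \<longrightarrow> c l (\<tau> l n) = \<theta> l n * f n - f (\<tau> l n))"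
    by blast
qed

end

section \<open>Freeness and minimality under torsion perturbations\<close>

lemma continuous_on_torus_iff:
  fixes f :: "'q::finite torus \<Rightarrow> 'b::topological_space"
  shows "continuous_on UNIV f \<longleftrightarrow> continuous_on UNIV (\<lambda>x. f (torus_proj x))"
  by (simp add: continuous_on_open_vimage open_torus_def vimage_comp comp_def)

lemma continuous_on_torus_proj: "continuous_on UNIV (torus_proj :: real ^ 'q::finite \<Rightarrow> _)"
  using continuous_on_torus_iff[of "\<lambda>x. x"] by simp

lemma continuous_on_torus_affine:
  assumes "\<And>x. f (torus_proj x) = torus_proj (real_mat B *v x + a)"
  shows "continuous_on UNIV f"
  unfolding continuous_on_torus_iff assms
  by (rule continuous_on_compose2[OF continuous_on_torus_proj]) (auto intro!: continuous_intros)

lemma real_mat_mat_1: "real_mat (mat 1) = mat 1"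
  by (simp add: vec_eq_iff mat_def)

lemma torus_mat_mat_1: "torus_mat (mat 1) t = t"
  using torus_proj_surj[of t] by (auto simp: torus_mat.abs_eq real_mat_mat_1)

lemma range_torus_proj: "range torus_proj = UNIV"
  using torus_proj_surj by blast

lemma connected_torus: "connected (UNIV :: 'q::finite torus set)"
  by (metis connected_UNIV connected_continuous_image continuous_on_torus_proj range_torus_proj)

lemma continuous_on_torus_translation: "continuous_on UNIV (\<lambda>t :: 'q::finite torus. t + a)"
proof -
  obtain y where "a = torus_proj y"
    using torus_proj_surj by blast
  then show ?thesis
    by (intro continuous_on_torus_affine[where B = "mat 1" and a = y])
      (simp add: plus_torus.abs_eq real_mat_mat_1)
qed

text \<open>For \<open>s \<ge> 1\<close> these are the points killed by multiplication with
  \<open>s\<close>.\<close>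

definition torsion :: "nat \<Rightarrow> 'q::finite torus set" where
  "torsion s = range (\<lambda>n. torus_proj ((1 / real s) *\<^sub>R real_vec n))"

lemma finite_torsion:
  assumes "s \<ge> 1"
  shows "finite (torsion s :: 'q::finite torus set)"
proof -
  let ?f = "\<lambda>n :: int ^ 'q. torus_proj ((1 / real s) *\<^sub>R real_vec n)"
  have "?f n \<in> ?f ` {n. \<forall>i. \<bar>n $ i\<bar> \<le> int s}" for n
  \<comment> \<open>Reducing each entry modulo \<open>s\<close> changes the vector by
    \<open>s\<close> times an integral one, which after division by \<open>s\<close> is a
    period.\<close>
  proof (intro image_eqI[of _ _ "\<chi> i. n $ i mod int s"])
    have "real_of_int (n $ i) - real_of_int (n $ i mod int s) = real s * real_of_int (n $ i div int s)"
      for i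
      by (metis (no_types, lifting) minus_mod_eq_mult_div of_int_diff of_int_mult of_int_of_nat_eq)
    then have "(1 / real s) *\<^sub>R real_vec n - (1 / real s) *\<^sub>R real_vec (\<chi> i. n $ i mod int s) =
        real_vec (\<chi> i. n $ i div int s)"
      using assms by (simp add: vec_eq_iff field_simps)
    then show "?f n = ?f (\<chi> i. n $ i mod int s)"
      unfolding torus_proj_eq_iff by blast
    show "(\<chi> i. n $ i mod int s) \<in> {n. \<forall>i. \<bar>n $ i\<bar> \<le> int s}"
      using assms by (simp add: order.strict_implies_order)
  qed
  then have "torsion s \<subseteq> ?f ` {n. \<forall>i. \<bar>n $ i\<bar> \<le> int s}"
    unfolding torsion_def by blast
  then show ?thesis
    using finite_subset finite_imageI[OF finite_bounded_vec] by blast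
qed

text \<open>Additivity makes \<open>\<phi> 0\<close> idempotent, and its invertible linear part
  makes it injective; an injective idempotent map is the identity.\<close>

lemma affine_action_0:
  assumes "affine_action \<phi>"
  shows "\<phi> 0 = id"
proof -
  obtain B a where B: "invertible B" "\<phi> 0 = (\<lambda>t. torus_mat B t + a)"
    using assms unfolding affine_action_def Affine_def by blast
  obtain C where C: "C ** B = mat 1"
    using B(1) unfolding invertible_def by blast
  have "torus_mat C (torus_mat B t) = t" for t
    by (simp add: C torus_mat_mat_1 flip: torus_mat_mult)
  then have "inj (\<phi> 0)"
    unfolding B(2) by (metis (mono_tags, lifting) add_right_cancel injI)
  moreover have "\<phi> 0 (\<phi> 0 t) = \<phi> 0 t" for t
    using assms unfolding affine_action_def by (metis add.right_neutral comp_apply)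
  ultimately show ?thesis
    by (auto simp: inj_def)
qed

lemma affine_action_add: "affine_action \<phi> \<Longrightarrow> \<phi> (l + l') x = \<phi> l (\<phi> l' x)"
  by (simp add: affine_action_def)

lemma affine_action_iterate:
  assumes "affine_action \<phi>" "\<phi> l x = x"
  shows "\<phi> (of_nat k *s l) x = x"
proof (induction k)
  case 0
  then show ?case
    using affine_action_0[OF assms(1)] by simp
next
  case (Suc k)
  then show ?case
    using affine_action_add[OF assms(1), of l "of_nat k *s l" x] assms(2)
    by (simp add: vector_sadd_rdistrib)
qed

lemma free_action_torsion_perturbation:
  assumes \<phi>: "affine_action \<phi>" and \<psi>: "affine_action \<psi>" and "s \<ge> 1"
    and tors: "\<And>l x. \<phi> l x - \<psi> l x \<in> torsion s"
    and free: "free_action \<phi>"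
  shows "free_action \<psi>"
  unfolding free_action_def
proof (intro allI impI notI)
  fix l x assume "l \<noteq> 0" "\<psi> l x = x"
  let ?y = "\<lambda>k :: nat. \<phi> (of_nat k *s l) x"
  \<comment> \<open>\<psi> fixes \<open>x\<close> along all multiples of \<open>l\<close>, so the
    images of \<open>x\<close> under \<phi> differ from \<open>x\<close> itself by torsion
    points.\<close>
  have "?y k \<in> (\<lambda>t. t + x) ` torsion s" for k
    using tors[of "of_nat k *s l" x] affine_action_iterate[OF \<psi> \<open>\<psi> l x = x\<close>, of k]
    by (intro image_eqI[of _ _ "?y k - x"]) auto
  then have "range ?y \<subseteq> (\<lambda>t. t + x) ` torsion s"
    by (rule image_subsetI)
  then have "finite (range ?y)"
    using finite_torsion[OF \<open>s \<ge> 1\<close>] by (metis finite_imageI finite_subset)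
  then have "\<not> inj ?y"
    using finite_imageD[of ?y UNIV] by auto
  then obtain j k :: nat where jk: "?y j = ?y k" "j \<noteq> k"
    by (auto simp: inj_on_def)
  \<comment> \<open>This difference fixes the point \<open>?y j\<close>; freeness forces it to be 0,
    although \<open>l\<close> has a nonzero entry.\<close>
  let ?d = "of_nat k *s l - of_nat j *s l"
  have "\<phi> ?d (?y j) = \<phi> (?d + of_nat j *s l) x"
    by (simp only: affine_action_add[OF \<phi>])
  also have "\<dots> = ?y j"
    by (simp add: jk(1))
  finally have "?d = 0"
    using free unfolding free_action_def by metis
  moreover obtain i where "l $ i \<noteq> 0"
    using \<open>l \<noteq> 0\<close> by (auto simp: vec_eq_iff)
  ultimately show False
    using jk(2) by (auto simp: vec_eq_iff)
qed

text \<open>The finite case of Baire's theorem; it excludes that finitely many translates of a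
  closed set with empty interior cover the torus.\<close>

lemma interior_finite_Union_closed:
  assumes "finite F" "\<And>S. S \<in> F \<Longrightarrow> closed S \<and> interior S = {}"
  shows "interior (\<Union>F) = {}"
  using assms
proof (induction F rule: finite_induct)
  case (insert S F)
  have "interior (S \<union> \<Union>F) = interior S"
    using insert by (intro interior_closed_Un_empty_interior) auto
  then show ?case
    using insert by simp
qed simp

lemma minimal_action_torsion_perturbation:
  fixes \<phi> \<psi> :: "int ^ 'p::finite \<Rightarrow> 'q::finite torus \<Rightarrow> 'q torus"
  assumes \<psi>: "affine_action \<psi>" and cont: "\<And>l. continuous_on UNIV (\<psi> l)" and "s \<ge> 1"
    and tors: "\<And>l x. \<phi> l x - \<psi> l x \<in> torsion s"
    and minimal: "minimal_action \<phi>"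
  shows "minimal_action \<psi>"
proof -
  define K where "K x = closure (range (\<lambda>l. \<psi> l x))" for x
  have K_closed: "closed (K x)" for x
    by (simp add: K_def)
  have inv: "\<psi> l y \<in> K x" if "y \<in> K x" for l x y
  proof -
    have "\<psi> l ` K x \<subseteq> closure (\<psi> l ` range (\<lambda>l. \<psi> l x))"
      unfolding K_def by (rule continuous_image_closure_subset[OF cont]) simp
    also have "\<psi> l ` range (\<lambda>l. \<psi> l x) \<subseteq> range (\<lambda>l. \<psi> l x)"
      by (auto simp flip: affine_action_add[OF \<psi>])
    then have "closure (\<psi> l ` range (\<lambda>l. \<psi> l x)) \<subseteq> K x"
      unfolding K_def by (rule closure_mono)
    finally show ?thesis
      using that by blast
  qed
  have inverse: "\<psi> (- l) (\<psi> l x) = x" for l x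
    using affine_action_add[OF \<psi>, of "- l" l x] affine_action_0[OF \<psi>] by simp
  have "interior (K x) \<noteq> {}" for x
  proof
    assume empty: "interior (K x) = {}"
    \<comment> \<open>Translates are preimages under the opposite translation, so their closedness
      follows from continuity.\<close>
    have vimage: "(\<lambda>y. y + t) ` K x = (\<lambda>y. y + (- t)) -` K x" for t
      by (force simp: image_iff)
    have "closed ((\<lambda>y. y + t) ` K x)" for t
      unfolding vimage using continuous_on_torus_translation[of "- t"] K_closed[of x]
      by (simp add: continuous_on_closed_vimage)
    moreover have "interior ((\<lambda>y. y + t) ` K x) = {}" for t
    proof -
      have "open ((\<lambda>y. y + t) -` interior ((\<lambda>y. y + t) ` K x))"
        using continuous_on_torus_translation[of t] by (simp add: continuous_on_open_vimage)
      moreover have "(\<lambda>y. y + t) -` interior ((\<lambda>y. y + t) ` K x) \<subseteq> K x"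
        using interior_subset[of "(\<lambda>y. y + t) ` K x"] by auto
      ultimately have "(\<lambda>y. y + t) -` interior ((\<lambda>y. y + t) ` K x) = {}"
        using empty interior_maximal by blast
      moreover have "z = z - t + t" for z
        by simp
      ultimately show ?thesis
        by (metis empty_iff equals0I vimageI2)
    qed
    ultimately have "interior (\<Union>t\<in>torsion s. (\<lambda>y. y + t) ` K x) = {}"
      and closed: "closed (\<Union>t\<in>torsion s. (\<lambda>y. y + t) ` K x)"
      using finite_torsion[OF \<open>s \<ge> 1\<close>, where 'q = 'q]
      by (auto intro!: interior_finite_Union_closed)
    moreover have "\<phi> l x \<in> (\<Union>t\<in>torsion s. (\<lambda>y. y + t) ` K x)" for l
    proof -
      have "\<psi> l x \<in> K x"
        unfolding K_def by (rule subsetD[OF closure_subset rangeI])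
      then show ?thesis
        using tors[of l x] by (intro UN_I[of "\<phi> l x - \<psi> l x"] image_eqI[of _ _ "\<psi> l x"]) auto
    qed
    then have "closure (range (\<lambda>l. \<phi> l x)) \<subseteq> (\<Union>t\<in>torsion s. (\<lambda>y. y + t) ` K x)"
      using closed by (intro closure_minimal) auto
    moreover have "closure (range (\<lambda>l. \<phi> l x)) = UNIV"
      using minimal by (simp add: minimal_action_def)
    ultimately show False
      by (simp add: top.extremum_unique)
  qed
  \<comment> \<open>The complement of the interior is invariant as well: the preimage of the
    interior is open and, as \<open>\<psi> (- l)\<close> preserves \<open>K x\<close>, contained in
    \<open>K x\<close>.\<close>
  moreover have "\<psi> l y \<notin> interior (K x)" if "y \<notin> interior (K x)" for l x y
  proof
    assume "\<psi> l y \<in> interior (K x)"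
    moreover have "open (\<psi> l -` interior (K x))"
      using cont[of l] by (simp add: continuous_on_open_vimage)
    moreover have "\<psi> l -` interior (K x) \<subseteq> K x"
      using inv[of _ x "- l"] interior_subset[of "K x"] inverse by (metis subsetD subsetI vimageE)
    ultimately show False
      using that interior_maximal by (metis subsetD vimageI)
  qed
  then have "K y \<subseteq> - interior (K x)" if "y \<notin> interior (K x)" for x y
    unfolding K_def[of y] using that by (intro closure_minimal) auto
  moreover have "K y \<subseteq> K x" if "y \<in> K x" for x y
    unfolding K_def[of y] using that inv K_closed by (intro closure_minimal) auto
  ultimately have "K x \<subseteq> interior (K x)" for x
  proof -
    \<comment> \<open>Otherwise the orbit closure of \<open>y\<close> would lie in
      \<open>K x\<close> but miss \<open>interior (K x)\<close>, and so have empty interior.\<close>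
    have "y \<in> interior (K x)" if "y \<in> K x" for y
    proof (rule ccontr)
      assume "y \<notin> interior (K x)"
      then have "interior (K y) \<subseteq> - interior (K x)"
        using \<open>\<And>y x. y \<notin> interior (K x) \<Longrightarrow> K y \<subseteq> - interior (K x)\<close> interior_subset[of "K y"] by blast
      moreover have "interior (K y) \<subseteq> interior (K x)"
        using \<open>\<And>y x. y \<in> K x \<Longrightarrow> K y \<subseteq> K x\<close> that by (intro interior_mono)
      ultimately show False
        using \<open>\<And>x. interior (K x) \<noteq> {}\<close>[of y] by blast
    qed
    then show ?thesis
      by blast
  qed
  then have "open (K x)" for x
    by (metis interior_subset interior_eq subset_antisym)
  moreover have "x \<in> K x" for x
    using affine_action_0[OF \<psi>] unfolding K_def by (metis closure_subset id_apply rangeI subsetD)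
  moreover have "K x = {} \<or> K x = UNIV" if "open (K x)" for x
    using that connected_clopen[THEN iffD1, OF connected_torus[where 'q = 'q]] K_closed by simp
  ultimately have "K x = UNIV" for x
    by blast
  then show ?thesis
    by (simp add: minimal_action_def K_def)
qed

section \<open>Fourier series on the torus\<close>

definition character :: "int ^ 'q::finite \<Rightarrow> real ^ 'q \<Rightarrow> complex" where
  "character n x = cis (2 * pi * (real_vec n \<bullet> x))"

lemma norm_character [simp]: "cmod (character n x) = 1"
  by (simp add: character_def)

lemma character_0 [simp]: "character 0 x = 1" "character n 0 = 1"
  by (simp_all add: character_def)

lemma character_add_right: "character n (x + y) = character n x * character n y"
  by (simp add: character_def inner_add_right ring_distribs flip: cis_mult)

lemma character_add_left: "character (m + n) x = character m x * character n x"
  by (simp add: character_def real_vec_add inner_add_left ring_distribs flip: cis_mult)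

lemma character_minus: "character (- n) x = cnj (character n x)"
  by (simp add: character_def real_vec_minus cis_cnj)

lemma character_real_vec [simp]: "character n (real_vec m) = 1"
proof -
  have "real_vec n \<bullet> real_vec m = real_of_int (\<Sum>i\<in>UNIV. n $ i * m $ i)"
    by (simp add: inner_vec_def)
  then show ?thesis
    unfolding character_def by (metis Ints_of_int cis_multiple_2pi)
qed

text \<open>Moving the matrix across the inner product transposes it; this is the origin of the
  transposed action on modes.\<close>

lemma character_real_mat: "character n (real_mat B *v x) = character (transpose B *v n) x"
proof -
  have "real_mat (transpose B) = transpose (real_mat B)"
    by (simp add: vec_eq_iff transpose_def)
  then have "real_vec (transpose B *v n) \<bullet> x = (transpose (real_mat B) *v real_vec n) \<bullet> x"
    by (simp only: real_vec_mult)
  also have "\<dots> = real_vec n \<bullet> (real_mat B *v x)"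
    by (simp only: transpose_matrix_vector dot_lmul_matrix)
  finally have "real_vec (transpose B *v n) \<bullet> x = real_vec n \<bullet> (real_mat B *v x)" .
  then show ?thesis
    by (simp only: character_def)
qed

lemma continuous_on_character [continuous_intros]: "continuous_on S (character n)"
  unfolding character_def [abs_def] by (auto intro!: continuous_intros)

lemma abs_mode_weight [simp]: "\<bar>mode_weight n\<bar> = mode_weight n"
  using mode_weight_ge_1[of n] by simp

lemma abs_inner_real_vec_le: "\<bar>real_vec n \<bullet> v\<bar> \<le> mode_weight n * norm v"
proof -
  have "\<bar>real_vec n \<bullet> v\<bar> \<le> (\<Sum>i\<in>UNIV. \<bar>real_of_int (n $ i)\<bar> * \<bar>v $ i\<bar>)"
    unfolding inner_vec_def by (rule order_trans[OF sum_abs]) (simp add: abs_mult)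
  also have "\<dots> \<le> (\<Sum>i\<in>UNIV. \<bar>real_of_int (n $ i)\<bar> * norm v)"
    by (intro sum_mono mult_left_mono component_le_norm_cart) auto
  also have "\<dots> \<le> mode_weight n * norm v"
    by (simp add: mode_weight_def ring_distribs flip: sum_distrib_right)
  finally show ?thesis .
qed

text \<open>Decay of order \<open>j + k\<close> absorbs a factor of polynomial growth, such as those
  produced by differentiation.\<close>

lemma rapid_mult_weight:
  assumes "rapid a" and le: "\<And>n. cmod (b n) \<le> K * (cmod (a n) * mode_weight n ^ j)" and "0 \<le> K"
  shows "rapid b"
  unfolding rapid_def
proof
  fix k
  obtain C where C: "\<And>n. cmod (a n) * mode_weight n ^ (j + k) \<le> C"
    using assms(1) unfolding rapid_def by blast
  have "cmod (b n) * mode_weight n ^ k \<le> K * C" for n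
  proof -
    have "cmod (b n) * mode_weight n ^ k \<le> K * (cmod (a n) * mode_weight n ^ j) * mode_weight n ^ k"
      using le mode_weight_ge_1[of n] by (intro mult_right_mono) auto
    also have "\<dots> = K * (cmod (a n) * mode_weight n ^ (j + k))"
      by (simp add: power_add)
    also have "\<dots> \<le> K * C"
      using C \<open>0 \<le> K\<close> by (rule mult_left_mono)
    finally show ?thesis .
  qed
  then show "\<exists>C. \<forall>n. cmod (b n) * mode_weight n ^ k \<le> C"
    by blast
qed

text \<open>The correction term makes the uniform bound 5 provable by induction: passing to
  \<open>N + 1\<close> adds the two terms at plus and minus \<open>N + 1\<close>, whose sum is at
  most \<open>4 / (N + 1) - 4 / (N + 2)\<close>.\<close>

lemma sum_inverse_squares_le: "(\<Sum>j\<in>{-int N..int N}. 1 / (1 + (real_of_int j)\<^sup>2)) \<le> 5 - 4 / (real N + 1)"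
proof (induction N)
  case (Suc N)
  have "{-int (Suc N)..int (Suc N)} = insert (int N + 1) (insert (- (int N + 1)) {-int N..int N})"
    by auto
  then have "(\<Sum>j\<in>{-int (Suc N)..int (Suc N)}. 1 / (1 + (real_of_int j)\<^sup>2)) =
      2 / (1 + (real N + 1)\<^sup>2) + (\<Sum>j\<in>{-int N..int N}. 1 / (1 + (real_of_int j)\<^sup>2))"
    by (simp add: power2_eq_square algebra_simps)
  also have "2 / (1 + (real N + 1)\<^sup>2) \<le> 4 / ((real N + 1) * (real N + 2))"
  proof -
    have "0 \<le> (real N)\<^sup>2"
      by simp
    then have "(real N + 1) * (real N + 2) \<le> 2 * (1 + (real N + 1)\<^sup>2)"
      by (simp add: power2_eq_square algebra_simps)
    moreover define X Y where "X = 1 + (real N + 1)\<^sup>2" and "Y = (real N + 1) * (real N + 2)"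
    moreover have "0 < X" "0 < Y"
      by (simp_all add: X_def Y_def add_pos_nonneg)
    ultimately have "2 / X \<le> 4 / Y"
      by (simp add: field_simps)
    then show ?thesis
      by (simp only: X_def Y_def)
  qed
  also have "\<dots> = 4 / (real N + 1) - 4 / (real N + 2)"
    by (simp add: field_simps)
  finally show ?case
    using Suc.IH by (simp add: add_ac)
qed simp

text \<open>The exponent spends one squared weight on each coordinate. As the squared weight is at
  least \<open>1 + (n $ i)\<^sup>2\<close> for every \<open>i\<close>, the summand is at most a
  product of one-dimensional terms, and each one-dimensional sum is at most 5.\<close>

lemma summable_mode_weight:
  "(\<lambda>n :: int ^ 'q::finite. 1 / mode_weight n ^ (2 * CARD('q))) summable_on UNIV"
proof (rule nonneg_bdd_above_summable_on)
  show "0 \<le> 1 / mode_weight n ^ (2 * CARD('q))" for n :: "int ^ 'q"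
    using mode_weight_ge_1[of n] by simp
  have "(\<Sum>n\<in>F. 1 / mode_weight n ^ (2 * CARD('q))) \<le> 5 ^ CARD('q)"
    if "finite F" for F :: "(int ^ 'q) set"
  proof -
    \<comment> \<open>Any common bound on the entries would do; it places \<open>F\<close> in a box,
      over which the sum of products factors.\<close>
    define N where "N = (\<Sum>n\<in>F. \<Sum>i\<in>UNIV. nat \<bar>n $ i\<bar>)"
    have N: "\<bar>n $ i\<bar> \<le> int N" if "n \<in> F" for n i
    proof -
      have "nat \<bar>n $ i\<bar> \<le> (\<Sum>i\<in>UNIV. nat \<bar>n $ i\<bar>)"
        by (rule member_le_sum) auto
      also have "\<dots> \<le> N"
        unfolding N_def using \<open>finite F\<close> that by (intro member_le_sum) auto
      finally show ?thesis
        by linarith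
    qed
    let ?h = "\<lambda>j. 1 / (1 + (real_of_int j)\<^sup>2)"
    have "1 / mode_weight n ^ (2 * CARD('q)) \<le> (\<Prod>i\<in>UNIV. ?h (n $ i))" for n :: "int ^ 'q"
    proof -
      have "1 / (mode_weight n)\<^sup>2 \<le> ?h (n $ i)" for i
      proof -
        have "1 + \<bar>real_of_int (n $ i)\<bar> \<le> mode_weight n"
          unfolding mode_weight_def by (intro add_left_mono member_le_sum) auto
        then have "(1 + \<bar>real_of_int (n $ i)\<bar>)\<^sup>2 \<le> (mode_weight n)\<^sup>2"
          by (intro power_mono) auto
        then have "1 + (real_of_int (n $ i))\<^sup>2 \<le> (mode_weight n)\<^sup>2"
          by (simp add: power2_eq_square algebra_simps)
        then show ?thesis
          by (intro frac_le) (auto intro: add_pos_nonneg)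
      qed
      then have "(\<Prod>i\<in>(UNIV :: 'q set). 1 / (mode_weight n)\<^sup>2) \<le> (\<Prod>i\<in>UNIV. ?h (n $ i))"
        by (intro prod_mono) auto
      then show ?thesis
        by (simp add: power_mult power_one_over)
    qed
    then have "(\<Sum>n\<in>F. 1 / mode_weight n ^ (2 * CARD('q))) \<le> (\<Sum>n\<in>F. \<Prod>i\<in>UNIV. ?h (n $ i))"
      by (intro sum_mono)
    also have "\<dots> = (\<Sum>g\<in>vec_nth ` F. \<Prod>i\<in>UNIV. ?h (g i))"
      by (subst sum.reindex) (auto simp: inj_on_def vec_eq_iff)
    also have "\<dots> \<le> (\<Sum>g\<in>PiE UNIV (\<lambda>i :: 'q. {-int N..int N}). \<Prod>i\<in>UNIV. ?h (g i))"
      using N by (intro sum_mono2 finite_PiE)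
        (auto intro!: prod_nonneg simp: abs_le_iff minus_le_iff)
    also have "\<dots> = (\<Prod>i\<in>(UNIV :: 'q set). \<Sum>j\<in>{-int N..int N}. ?h j)"
      by (rule prod_sum_PiE[symmetric]) auto
    also have "\<dots> \<le> (\<Prod>i\<in>(UNIV :: 'q set). 5)"
    proof (rule prod_mono)
      have "(\<Sum>j\<in>{-int N..int N}. ?h j) \<le> 5"
        by (rule order_trans[OF sum_inverse_squares_le]) simp
      then show "0 \<le> (\<Sum>j\<in>{-int N..int N}. ?h j) \<and> (\<Sum>j\<in>{-int N..int N}. ?h j) \<le> 5"
        by (simp add: sum_nonneg)
    qed
    finally show ?thesis
      by simp
  qed
  then show "bdd_above (sum (\<lambda>n :: int ^ 'q. 1 / mode_weight n ^ (2 * CARD('q))) ` {F. F \<subseteq> UNIV \<and> finite F})"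
    by (intro bdd_aboveI[of _ "5 ^ CARD('q)"]) auto
qed

lemma rapid_abs_summable:
  fixes a :: "int ^ 'q::finite \<Rightarrow> complex"
  assumes "rapid a"
  shows "(\<lambda>n. cmod (a n)) summable_on UNIV"
proof -
  obtain C where C: "\<And>n. cmod (a n) * mode_weight n ^ (2 * CARD('q)) \<le> C"
    using assms unfolding rapid_def by blast
  have le: "cmod (a n) \<le> C * (1 / mode_weight n ^ (2 * CARD('q)))" for n
    using C[of n] mode_weight_ge_1[of n] by (simp add: field_simps)
  have "(\<lambda>n :: int ^ 'q. C * (1 / mode_weight n ^ (2 * CARD('q)))) summable_on UNIV"
    by (rule summable_on_cmult_right[OF summable_mode_weight])
  then show ?thesis
    by (rule summable_on_comparison_test) (simp_all only: le norm_ge_zero)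
qed

section \<open>Trigonometric series and their smoothness\<close>

definition trig_series :: "(int ^ 'q::finite \<Rightarrow> complex) \<Rightarrow> real ^ 'q \<Rightarrow> complex" where
  "trig_series a x = (\<Sum>\<^sub>\<infinity>n. a n * character n x)"

lemma trig_series_abs_summable:
  "rapid a \<Longrightarrow> (\<lambda>n. cmod (a n * character n x)) summable_on UNIV"
  using rapid_abs_summable[of a] by (simp add: norm_mult)

lemma has_sum_trig_series:
  "rapid a \<Longrightarrow> ((\<lambda>n. a n * character n x) has_sum trig_series a x) UNIV"
  unfolding trig_series_def
  by (rule has_sum_infsum[OF abs_summable_summable[OF trig_series_abs_summable]])

lemma trig_series_real_vec [simp]: "trig_series a (x + real_vec m) = trig_series a x"
  by (simp add: trig_series_def character_add_right)

text \<open>The first-order Taylor remainder of \<open>exp\<close> on the imaginary axis; it gives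
  the quadratic error in termwise differentiation.\<close>

lemma norm_cis_minus_linear_le: "cmod (cis t - 1 - \<i> * of_real t) \<le> t\<^sup>2"
proof -
  have "cmod (exp (\<i> * of_real t) - (\<Sum>k\<le>1. (\<i> * of_real t) ^ k / fact k)) \<le> t\<^sup>2"
    using Taylor_exp[of "\<i> * of_real t" 1] by (simp add: norm_mult power2_eq_square)
  then show ?thesis
    by (simp add: cis_conv_exp algebra_simps)
qed

lemma rapid_derivative:
  assumes "rapid a"
  shows "rapid (\<lambda>n. 2 * pi * \<i> * of_real (real_vec n \<bullet> v) * a n)"
proof (rule rapid_mult_weight[OF assms, where j = 1 and K = "2 * pi * norm v"])
  fix n
  have "\<bar>real_vec n \<bullet> v\<bar> * cmod (a n) \<le> mode_weight n * norm v * cmod (a n)"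
    by (intro mult_right_mono abs_inner_real_vec_le) auto
  then show "cmod (2 * pi * \<i> * of_real (real_vec n \<bullet> v) * a n) \<le>
      2 * pi * norm v * (cmod (a n) * mode_weight n ^ 1)"
    by (simp add: norm_mult mult_ac)
qed simp

text \<open>Termwise differentiation: the remainder of mode \<open>n\<close> is at most a constant
  times \<open>cmod (a n)\<close>, the squared weight and the squared increment, and the sum over
  all modes converges by rapid decay.\<close>

lemma has_derivative_trig_series:
  assumes "rapid a"
  shows "(trig_series a has_derivative
     (\<lambda>v. trig_series (\<lambda>n. 2 * pi * \<i> * of_real (real_vec n \<bullet> v) * a n) x)) (at x)"
proof -
  define D where "D v = trig_series (\<lambda>n. 2 * pi * \<i> * of_real (real_vec n \<bullet> v) * a n) x" for v
  have D: "((\<lambda>n. 2 * pi * \<i> * of_real (real_vec n \<bullet> v) * a n * character n x) has_sum D v) UNIV" for v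
    unfolding D_def by (rule has_sum_trig_series[OF rapid_derivative[OF assms]])
  \<comment> \<open>Weighted absolute sums of the coefficients: \<open>K 1\<close> bounds the
    derivative as a linear map, \<open>K 2\<close> its remainder.\<close>
  define K where "K j = (\<Sum>\<^sub>\<infinity>n. cmod (a n) * mode_weight n ^ j)" for j
  have K: "((\<lambda>n. cmod (a n) * mode_weight n ^ j) has_sum K j) UNIV" for j
  proof -
    have "rapid (\<lambda>n. a n * of_real (mode_weight n ^ j))"
      by (intro rapid_mult_weight[OF assms, where j = j and K = 1])
        (simp_all add: norm_mult norm_power)
    from rapid_abs_summable[OF this] show ?thesis
      unfolding K_def by (simp add: norm_mult norm_power)
  qed
  have "bounded_linear D"
  proof (rule bounded_linear_intro)
    fix v w :: "real ^ 'a" and r :: real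
    show "D (v + w) = D v + D w"
      using has_sum_add[OF D[of v] D[of w]]
      by (intro has_sum_unique[OF D]) (simp add: inner_add_right algebra_simps)
    show "D (r *\<^sub>R v) = r *\<^sub>R D v"
      using has_sum_cmult_right[OF D[of v], of "of_real r"]
      by (intro has_sum_unique[OF D]) (simp add: scaleR_conv_of_real[where 'a = complex] mult_ac)
    have "cmod (D v) \<le> 2 * pi * norm v * K 1"
    proof (rule norm_infsum_le[OF D has_sum_cmult_right[OF K]])
      fix n
      have "\<bar>real_vec n \<bullet> v\<bar> * cmod (a n) \<le> mode_weight n * norm v * cmod (a n)"
        by (intro mult_right_mono abs_inner_real_vec_le) auto
      then show "cmod (2 * pi * \<i> * of_real (real_vec n \<bullet> v) * a n * character n x) \<le>
          2 * pi * norm v * (cmod (a n) * mode_weight n ^ 1)"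
        by (simp add: norm_mult mult_ac)
    qed
    then show "norm (D v) \<le> norm v * (2 * pi * K 1)"
      by (simp add: mult_ac)
  qed
  then have "(trig_series a has_derivative D) (at x)"
  proof (rule has_derivativeI_sandwich[where e = 1 and H = "\<lambda>y. (2 * pi)\<^sup>2 * K 2 * norm (y - x)", rotated])
    fix y
    assume "y \<noteq> x"
    define v where "v = y - x"
    have "((\<lambda>n. a n * character n y - a n * character n x -
        2 * pi * \<i> * of_real (real_vec n \<bullet> v) * a n * character n x) has_sum
        (trig_series a y - trig_series a x - D v)) UNIV"
      using has_sum_add[OF has_sum_add[OF has_sum_trig_series[OF assms, of y]
            has_sum_uminusI[OF has_sum_trig_series[OF assms, of x]]] has_sum_uminusI[OF D[of v]]]
      by simp
    then have "cmod (trig_series a y - trig_series a x - D v) \<le> (2 * pi)\<^sup>2 * (norm v)\<^sup>2 * K 2"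
    proof (rule norm_infsum_le[OF _ has_sum_cmult_right[OF K]])
      fix n
      define t where "t = 2 * pi * (real_vec n \<bullet> v)"
      have "y = x + v"
        by (simp add: v_def)
      then have "character n y = character n x * cis t"
        by (simp add: character_add_right) (simp add: character_def t_def)
      then have "a n * character n y - a n * character n x -
          2 * pi * \<i> * of_real (real_vec n \<bullet> v) * a n * character n x =
          a n * character n x * (cis t - 1 - \<i> * of_real t)"
        by (simp add: t_def algebra_simps)
      then have "cmod (a n * character n y - a n * character n x -
          2 * pi * \<i> * of_real (real_vec n \<bullet> v) * a n * character n x) =
          cmod (a n) * cmod (cis t - 1 - \<i> * of_real t)"
        by (simp add: norm_mult)
      also have "\<dots> \<le> cmod (a n) * t\<^sup>2"
        by (intro mult_left_mono norm_cis_minus_linear_le) simp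
      also have "t\<^sup>2 \<le> (2 * pi)\<^sup>2 * (mode_weight n * norm v)\<^sup>2"
        unfolding t_def power_mult_distrib[of "2 * pi"]
        using power_mono[OF abs_inner_real_vec_le[of n v], of 2] by (intro mult_left_mono) auto
      then have "cmod (a n) * t\<^sup>2 \<le> cmod (a n) * ((2 * pi)\<^sup>2 * (mode_weight n * norm v)\<^sup>2)"
        by (rule mult_left_mono) simp
      finally show "cmod (a n * character n y - a n * character n x -
          2 * pi * \<i> * of_real (real_vec n \<bullet> v) * a n * character n x) \<le>
          (2 * pi)\<^sup>2 * (norm v)\<^sup>2 * (cmod (a n) * mode_weight n ^ 2)"
        by (simp only: power_mult_distrib mult_ac)
    qed
    then show "norm (trig_series a y - trig_series a x - D (y - x)) / norm (y - x) \<le>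
        (2 * pi)\<^sup>2 * K 2 * norm (y - x)"
      using \<open>y \<noteq> x\<close> by (simp add: v_def divide_le_eq power2_eq_square mult_ac)
  next
    have "((\<lambda>y. (2 * pi)\<^sup>2 * K 2 * norm (y - x)) \<longlongrightarrow> (2 * pi)\<^sup>2 * K 2 * norm (x - x)) (at x)"
      by (intro tendsto_intros)
    then show "((\<lambda>y. (2 * pi)\<^sup>2 * K 2 * norm (y - x)) \<longlongrightarrow> 0) (at x)"
      by simp
  qed simp
  then show ?thesis
    by (simp add: D_def [abs_def])
qed

lemma continuous_on_trig_series: "rapid a \<Longrightarrow> continuous_on S (trig_series a)"
  by (rule has_derivative_continuous_on[OF has_derivative_at_withinI[OF has_derivative_trig_series]])

lemma class_C_trig_series: "rapid a \<Longrightarrow> class_C k (trig_series a)"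
proof (induction k arbitrary: a)
  case 0
  then show ?case
    by (simp add: continuous_on_trig_series)
next
  case (Suc k)
  show ?case
    unfolding class_C.simps
    by (intro exI[of _ "\<lambda>x v. trig_series (\<lambda>n. 2 * pi * \<i> * of_real (real_vec n \<bullet> v) * a n) x"]
        conjI allI has_derivative_trig_series[OF Suc.prems] Suc.IH[OF rapid_derivative[OF Suc.prems]])
qed

lemma character_has_derivative:
  "(character n has_derivative (\<lambda>h. 2 * pi * \<i> * of_real (real_vec n \<bullet> h) * character n x)) (at x)"
proof -
  have eq: "character n = (\<lambda>x. exp (of_real (2 * pi * (real_vec n \<bullet> x)) * \<i>))"
    by (simp add: fun_eq_iff character_def cis_conv_exp mult_ac)
  have "((\<lambda>x. of_real (2 * pi * (real_vec n \<bullet> x)) * \<i>) has_derivative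
      (\<lambda>h. of_real (2 * pi * (real_vec n \<bullet> h)) * \<i>)) (at x)"
    by (auto intro!: derivative_eq_intros)
  from has_derivative_compose[OF this has_field_derivative_imp_has_derivative[OF DERIV_exp]]
  show ?thesis
    unfolding eq by (simp add: mult_ac)
qed

section \<open>Integrals of periodic functions over the unit cube\<close>

lemma mem_cbox_cart_split:
  fixes a b x :: "real ^ 'q"
  shows "x \<in> cbox a b \<longleftrightarrow>
    a $ i \<le> x $ i \<and> x $ i \<le> b $ i \<and> (\<forall>j. j \<noteq> i \<longrightarrow> a $ j \<le> x $ j \<and> x $ j \<le> b $ j)"
  unfolding mem_box_cart by metis

text \<open>The slab that leaves the cube under the shift is one period away from the slab that
  enters it.\<close>

lemma integral_unit_cube_shift:
  fixes u :: "real ^ 'q \<Rightarrow> complex"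
  assumes cont: "continuous_on UNIV u" and per: "\<And>x m. u (x + real_vec m) = u x"
    and t: "0 \<le> t" "t \<le> 1"
  shows "integral (cbox 0 1) (\<lambda>x. u (x + t *\<^sub>R axis i 1)) = integral (cbox 0 1) u"
proof -
  define e :: "real ^ 'q" where "e = axis i 1"
  have e: "e \<in> Basis" "\<And>x. x \<bullet> e = x $ i" "\<And>j. e $ j = (if j = i then 1 else 0)"
    by (simp_all add: e_def axis_in_Basis_iff inner_axis) (simp add: axis_def)
  have int: "u integrable_on cbox a b" for a b
    using cont by (intro integrable_continuous) (rule continuous_on_subset, auto)
  \<comment> \<open>\<open>?P\<close> and \<open>?Q\<close> are the parts of the cube below and
    above \<open>t\<close> in direction \<open>i\<close>; the shifted cube consists of
    \<open>?Q\<close> and the translate of \<open>?P\<close> by \<open>e\<close>.\<close>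
  let ?P = "cbox 0 (1 - (1 - t) *\<^sub>R e)" and ?Q = "cbox (t *\<^sub>R e) 1"
  have "cbox 0 1 \<inter> {x. x \<bullet> e \<le> t} = ?P" "cbox 0 1 \<inter> {x. x \<bullet> e \<ge> t} = ?Q"
    using t by (auto simp: mem_cbox_cart_split[where i = i] e)
  then have 1: "integral (cbox 0 1) u = integral ?P u + integral ?Q u"
    using integral_split[OF int e(1), of 0 1 t] by simp
  have "cbox (t *\<^sub>R e) (1 + t *\<^sub>R e) \<inter> {x. x \<bullet> e \<le> 1} = ?Q"
      "cbox (t *\<^sub>R e) (1 + t *\<^sub>R e) \<inter> {x. x \<bullet> e \<ge> 1} = cbox e (1 + t *\<^sub>R e)"
    using t by (auto simp: mem_cbox_cart_split[where i = i] e)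
  then have 2: "integral (cbox (t *\<^sub>R e) (1 + t *\<^sub>R e)) u =
      integral ?Q u + integral (cbox e (1 + t *\<^sub>R e)) u"
    using integral_split[OF int e(1), of "t *\<^sub>R e" "1 + t *\<^sub>R e" 1] by simp
  have "e = real_vec (axis i 1)"
    by (simp add: e_def vec_eq_iff axis_def)
  then have "u \<circ> (+) e = u"
    using per by (auto simp: fun_eq_iff add.commute)
  moreover have eq: "1 - (1 - t) *\<^sub>R e + e = 1 + t *\<^sub>R e"
    by (simp add: algebra_simps)
  ultimately have 3: "integral (cbox e (1 + t *\<^sub>R e)) u = integral ?P u"
    using integral_shift_cbox_plus[of 0 "1 - (1 - t) *\<^sub>R e" u e] unfolding eq by simp
  have "integral (cbox 0 1) (u \<circ> (+) (t *\<^sub>R e)) = integral (cbox (t *\<^sub>R e) (1 + t *\<^sub>R e)) u"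
    using integral_shift_cbox_plus[of 0 1 u "t *\<^sub>R e"] by simp
  also have "\<dots> = integral (cbox 0 1) u"
    using 1 2 3 by simp
  finally show ?thesis
    by (simp add: comp_def e_def add.commute)
qed

text \<open>The integral of the translates of \<open>u\<close> along the axis is constant in the
  shift; differentiation under the integral at shift 0 gives the claim.\<close>

lemma integral_unit_cube_derivative:
  fixes u :: "real ^ 'q \<Rightarrow> complex"
  assumes der: "\<And>x. (u has_derivative u' x) (at x)"
    and cont: "continuous_on UNIV (\<lambda>x. u' x (axis i 1))"
    and per: "\<And>x m. u (x + real_vec m) = u x"
  shows "integral (cbox 0 1) (\<lambda>x. u' x (axis i 1)) = 0"
proof -
  define e :: "real ^ 'q" where "e = axis i 1"
  have u: "continuous_on UNIV u"
    by (rule has_derivative_continuous_on[OF has_derivative_at_withinI[OF der]])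
  have vder: "((\<lambda>t. u (x + t *\<^sub>R e)) has_vector_derivative u' (x + t *\<^sub>R e) e) (at t within S)" for x t S
  proof -
    have "((\<lambda>t. x + t *\<^sub>R e) has_derivative (\<lambda>h. h *\<^sub>R e)) (at t)"
      by (auto intro!: derivative_eq_intros)
    from has_derivative_compose[OF this der]
    have "((\<lambda>t. u (x + t *\<^sub>R e)) has_derivative (\<lambda>h. u' (x + t *\<^sub>R e) (h *\<^sub>R e))) (at t)" .
    moreover have "u' (x + t *\<^sub>R e) (h *\<^sub>R e) = h *\<^sub>R u' (x + t *\<^sub>R e) e" for h
      using has_derivative_bounded_linear[OF der] by (simp add: linear_simps)
    ultimately show ?thesis
      by (simp add: has_vector_derivative_def has_derivative_at_withinI)
  qed
  have "((\<lambda>t. integral (cbox 0 1) (\<lambda>x. u (x + t *\<^sub>R e))) has_vector_derivative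
      integral (cbox 0 1) (\<lambda>x. u' (x + 0 *\<^sub>R e) e)) (at 0 within {0..1})"
  proof (rule leibniz_rule_vector_derivative[where fx = "\<lambda>t x. u' (x + t *\<^sub>R e) e"])
    show "((\<lambda>t. u (x + t *\<^sub>R e)) has_vector_derivative u' (x + t *\<^sub>R e) e) (at t within {0..1})" for t x
      by (rule vder)
    show "(\<lambda>x. u (x + t *\<^sub>R e)) integrable_on cbox 0 1" for t
      by (intro integrable_continuous continuous_on_compose2[OF u]) (auto intro!: continuous_intros)
    show "continuous_on ({0..1} \<times> cbox 0 1) (\<lambda>(t, x). u' (x + t *\<^sub>R e) e)"
      unfolding split_beta e_def
      by (rule continuous_on_compose2[OF cont]) (auto intro!: continuous_intros)
  qed auto
  moreover have "((\<lambda>t. integral (cbox 0 1) (\<lambda>x. u (x + t *\<^sub>R e))) has_vector_derivative 0)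
      (at 0 within {0..1})"
    by (rule has_vector_derivative_transform[where f = "\<lambda>_. integral (cbox 0 1) u"])
      (auto simp: e_def integral_unit_cube_shift[OF u per])
  \<comment> \<open>The shifts range over \<open>{0..1}\<close>, so the derivative at 0 is
    one-sided; it is unique because 0 is a limit point of this interval.\<close>
  moreover have "at (0::real) within {0..1} \<noteq> bot"
    by (simp add: trivial_limit_within islimpt_greaterThanLessThan1 islimpt_Icc)
  ultimately show ?thesis
    using vector_derivative_unique_within by (fastforce simp: e_def)
qed

text \<open>For \<open>n \<noteq> 0\<close>, a shift by half a period in a direction with nonzero
  entry changes the sign of the character but not its integral.\<close>

lemma integral_character:
  "integral (cbox 0 1) (character n) = (if n = 0 then 1 else 0)"
proof (cases "n = 0")
  case True
  have "measure lborel (cbox 0 (1 :: real ^ 'a)) = 1"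
    by (simp add: content_cbox_if_cart) (auto simp: interval_ne_empty_cart)
  then show ?thesis
    using True by (simp add: character_def [abs_def])
next
  case False
  then obtain i where i: "n $ i \<noteq> 0"
    by (auto simp: vec_eq_iff)
  define t where "t = 1 / (2 * \<bar>real_of_int (n $ i)\<bar>)"
  have "1 \<le> \<bar>real_of_int (n $ i)\<bar>"
    using i by linarith
  then have t: "0 \<le> t" "t \<le> 1"
    by (auto simp: t_def divide_le_eq)
  have "2 * pi * (real_of_int (n $ i) * t) = pi \<or> 2 * pi * (real_of_int (n $ i) * t) = - pi"
    using i by (cases "n $ i > 0") (auto simp: t_def field_simps)
  then have "cis (2 * pi * (real_of_int (n $ i) * t)) = - 1"
    by (metis cis_cnj cis_pi complex_cnj_minus complex_cnj_one)
  then have "character n (x + t *\<^sub>R axis i 1) = - character n x" for x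
    by (simp add: character_add_right) (simp add: character_def inner_axis mult_ac)
  then have "integral (cbox 0 1) (character n) = integral (cbox 0 1) (\<lambda>x. - character n x)"
    using integral_unit_cube_shift[of "character n" t i] t
    by (simp add: character_add_right continuous_on_character)
  then show ?thesis
    using False by simp
qed

section \<open>Fourier coefficients and their decay\<close>

definition fourier_coeff :: "(real ^ 'q::finite \<Rightarrow> complex) \<Rightarrow> int ^ 'q \<Rightarrow> complex" where
  "fourier_coeff u n = integral (cbox 0 1) (\<lambda>x. u x * character (- n) x)"

lemma fourier_coeff_integrable:
  "continuous_on UNIV u \<Longrightarrow> (\<lambda>x. u x * character n x) integrable_on cbox 0 1"
  by (intro integrable_continuous continuous_intros) (rule continuous_on_subset, auto)

text \<open>The partial sums converge uniformly by the Weierstrass test, so integrals pass to the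
  limit; by orthogonality each finite sum containing \<open>n\<close> contributes exactly
  \<open>a n\<close>.\<close>

lemma fourier_coeff_trig_series:
  assumes "rapid a"
  shows "fourier_coeff (trig_series a) n = a n"
proof -
  let ?f = "\<lambda>F x. \<Sum>m\<in>F. a m * character m x * character (- n) x"
  have "uniform_limit (cbox 0 1) ?f (\<lambda>x. \<Sum>\<^sub>\<infinity>m. a m * character m x * character (- n) x)
      (finite_subsets_at_top UNIV)"
    by (rule Weierstrass_m_test_general[OF _ rapid_abs_summable[OF assms]]) (simp add: norm_mult)
  moreover have "(\<Sum>\<^sub>\<infinity>m. a m * character m x * character (- n) x) =
      trig_series a x * character (- n) x" for x
    unfolding trig_series_def by (rule infsum_cmult_left')
  ultimately have "uniform_limit (cbox 0 1) ?f (\<lambda>x. trig_series a x * character (- n) x)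
      (finite_subsets_at_top UNIV)"
    by simp
  then obtain I J where I: "\<And>F. (?f F has_integral I F) (cbox 0 1)"
    and J: "((\<lambda>x. trig_series a x * character (- n) x) has_integral J) (cbox 0 1)"
    and lim: "(I \<longlongrightarrow> J) (finite_subsets_at_top UNIV)"
    by (rule uniform_limit_integral_cbox) (auto intro!: continuous_intros)
  have "I F = a n" if "finite F" "n \<in> F" for F
  proof -
    have ch: "((\<lambda>x. a m * character m x * character (- n) x) has_integral (if m = n then a m else 0))
        (cbox 0 1)" for m
    proof -
      have "(character (m + - n) has_integral (if m + - n = 0 then 1 else 0)) (cbox 0 1)"
        unfolding integral_character[symmetric]
        by (intro integrable_integral integrable_continuous continuous_on_character)
      from has_integral_mult_right[OF this, of "a m"]
      have "((\<lambda>x. a m * character (m + - n) x) has_integral (if m = n then a m else 0)) (cbox 0 1)"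
        by (cases "m = n") simp_all
      then show ?thesis
        by (simp only: character_add_left mult.assoc)
    qed
    have "(?f F has_integral (\<Sum>m\<in>F. if m = n then a m else 0)) (cbox 0 1)"
      by (intro has_integral_sum that ch)
    then show ?thesis
      using I[of F] that by (simp add: has_integral_unique)
  qed
  then have "\<forall>\<^sub>F F in finite_subsets_at_top UNIV. I F = a n"
    unfolding eventually_finite_subsets_at_top by (intro exI[of _ "{n}"]) auto
  then have "(I \<longlongrightarrow> a n) (finite_subsets_at_top UNIV)"
    by (rule tendsto_eventually)
  then have "J = a n"
    using lim by (intro tendsto_unique[OF finite_subsets_at_top_neq_bot])
  then show ?thesis
    using J unfolding fourier_coeff_def by (simp add: integral_unique)
qed

text \<open>The derivative provided by \<open>class_C (Suc k)\<close> depends on \<open>k\<close> a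
  priori; uniqueness of derivatives identifies them all.\<close>

lemma smooth_derivative:
  assumes "\<And>k. class_C k u"
  obtains u' where "\<And>x. (u has_derivative u' x) (at x)" "\<And>k v. class_C k (\<lambda>x. u' x v)"
proof -
  obtain u' where u': "\<And>x. (u has_derivative u' x) (at x)"
    using assms[of 1] by auto
  have "class_C k (\<lambda>x. u' x v)" for k v
  proof -
    obtain g where g: "\<And>x. (u has_derivative g x) (at x)" "\<And>v. class_C k (\<lambda>x. g x v)"
      using assms[of "Suc k"] by auto
    then have "g = u'"
      using has_derivative_unique[OF _ u'] by blast
    then show ?thesis
      using g(2) by simp
  qed
  with u' show ?thesis
    by (rule that)
qed

text \<open>Integration by parts without boundary term: the product of \<open>u\<close> with a
  character is periodic, so the integral of its partial derivative vanishes.\<close>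

lemma fourier_coeff_derivative:
  fixes u :: "real ^ 'q::finite \<Rightarrow> complex"
  assumes der: "\<And>x. (u has_derivative u' x) (at x)"
    and cont: "continuous_on UNIV (\<lambda>x. u' x (axis i 1))"
    and per: "\<And>x m. u (x + real_vec m) = u x"
  shows "fourier_coeff (\<lambda>x. u' x (axis i 1)) n = 2 * pi * \<i> * of_int (n $ i) * fourier_coeff u n"
proof -
  have u: "continuous_on UNIV u"
    by (rule has_derivative_continuous_on[OF has_derivative_at_withinI[OF der]])
  let ?v' = "\<lambda>x h. u x * (2 * pi * \<i> * of_real (real_vec (- n) \<bullet> h) * character (- n) x) +
      u' x h * character (- n) x"
  have v': "?v' x (axis i 1) = u' x (axis i 1) * character (- n) x -
      2 * pi * \<i> * of_int (n $ i) * (u x * character (- n) x)" for x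
    by (simp add: inner_axis)
  have "integral (cbox 0 1) (\<lambda>x. ?v' x (axis i 1)) = 0"
  proof (rule integral_unit_cube_derivative)
    show "((\<lambda>x. u x * character (- n) x) has_derivative ?v' x) (at x)" for x
      by (rule has_derivative_mult[OF der character_has_derivative])
    show "continuous_on UNIV (\<lambda>x. ?v' x (axis i 1))"
      unfolding v' by (intro continuous_intros cont u)
    show "u (x + real_vec m) * character (- n) (x + real_vec m) = u x * character (- n) x" for x m
      by (simp add: per character_add_right)
  qed
  moreover have "((\<lambda>x. ?v' x (axis i 1)) has_integral
      fourier_coeff (\<lambda>x. u' x (axis i 1)) n - 2 * pi * \<i> * of_int (n $ i) * fourier_coeff u n) (cbox 0 1)"
    unfolding v' fourier_coeff_def
    by (intro has_integral_diff has_integral_mult_right integrable_integral fourier_coeff_integrable cont u)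
  ultimately show ?thesis
    by (simp add: integral_unique)
qed

text \<open>Each derivative in direction \<open>i\<close> yields one factor \<open>n $ i\<close>,
  the constant \<open>2 * pi\<close> being at least 1. The derivative is again smooth and periodic,
  so the induction runs over all such functions.\<close>

lemma fourier_coeff_coordinate_decay:
  fixes u :: "real ^ 'q::finite \<Rightarrow> complex"
  assumes "\<And>k. class_C k u" and "\<And>x m. u (x + real_vec m) = u x"
  shows "\<exists>C. \<forall>n. cmod (fourier_coeff u n) * \<bar>real_of_int (n $ i)\<bar> ^ j \<le> C"
  using assms
proof (induction j arbitrary: u)
  case 0
  have u: "continuous_on UNIV u"
    using 0(1)[of 0] by simp
  then have "continuous_on (cbox 0 1) (\<lambda>x. cmod (u x))"
    by (intro continuous_intros) (rule continuous_on_subset, auto)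
  then have "(\<lambda>x. cmod (u x)) integrable_on cbox 0 1"
    by (rule integrable_continuous)
  then have "cmod (fourier_coeff u n) \<le> integral (cbox 0 1) (\<lambda>x. cmod (u x))" for n
    unfolding fourier_coeff_def
    by (intro integral_norm_bound_integral fourier_coeff_integrable u) (auto simp: norm_mult)
  then show ?case
    by auto
next
  case (Suc j)
  obtain u' where u': "\<And>x. (u has_derivative u' x) (at x)" "\<And>k v. class_C k (\<lambda>x. u' x v)"
    using smooth_derivative Suc.prems(1) by blast
  have per: "u' (x + real_vec m) v = u' x v" for x m v
  proof -
    have "((\<lambda>y. y + real_vec m) has_derivative (\<lambda>h. h)) (at x)"
      by (auto intro!: derivative_eq_intros)
    from has_derivative_compose[OF this u'(1)]
    have "(u has_derivative u' (x + real_vec m)) (at x)"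
      by (simp add: Suc.prems(2))
    then show ?thesis
      using has_derivative_unique[OF u'(1)] by metis
  qed
  obtain C where C: "\<And>n. cmod (fourier_coeff (\<lambda>x. u' x (axis i 1)) n) * \<bar>real_of_int (n $ i)\<bar> ^ j \<le> C"
    using Suc.IH[OF u'(2) per] by blast
  have "cmod (fourier_coeff u n) * \<bar>real_of_int (n $ i)\<bar> ^ Suc j \<le> C" for n
  proof -
    have "continuous_on UNIV (\<lambda>x. u' x (axis i 1))"
      using u'(2)[of 0] by simp
    from fourier_coeff_derivative[OF u'(1) this Suc.prems(2), of n]
    have "cmod (fourier_coeff (\<lambda>x. u' x (axis i 1)) n) =
        2 * pi * (\<bar>real_of_int (n $ i)\<bar> * cmod (fourier_coeff u n))"
      by (simp add: norm_mult)
    moreover have "1 * (\<bar>real_of_int (n $ i)\<bar> * cmod (fourier_coeff u n)) \<le>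
        2 * pi * (\<bar>real_of_int (n $ i)\<bar> * cmod (fourier_coeff u n))"
      using pi_ge_two by (intro mult_right_mono) auto
    ultimately have "\<bar>real_of_int (n $ i)\<bar> * cmod (fourier_coeff u n) * \<bar>real_of_int (n $ i)\<bar> ^ j \<le>
        cmod (fourier_coeff (\<lambda>x. u' x (axis i 1)) n) * \<bar>real_of_int (n $ i)\<bar> ^ j"
      by (intro mult_right_mono) auto
    also have "\<dots> \<le> C"
      by (rule C)
    finally show ?thesis
      by (simp add: mult_ac)
  qed
  then show ?case
    by blast
qed

text \<open>All entries are bounded by the largest one, so the weight is at most
  \<open>1 + CARD('q)\<close> times its maximum with 1. This combines decay in single coordinates
  into rapid decay.\<close>

lemma mode_weight_power_le:
  fixes n :: "int ^ 'q::finite"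
  shows "mode_weight n ^ k \<le> (1 + real CARD('q)) ^ k * (1 + (\<Sum>i\<in>UNIV. \<bar>real_of_int (n $ i)\<bar> ^ k))"
proof -
  define M where "M = Max (range (\<lambda>i. \<bar>real_of_int (n $ i)\<bar>))"
  have "M \<in> range (\<lambda>i. \<bar>real_of_int (n $ i)\<bar>)"
    unfolding M_def by (rule Max_in) auto
  then obtain i where i: "M = \<bar>real_of_int (n $ i)\<bar>"
    by blast
  have M: "\<bar>real_of_int (n $ j)\<bar> \<le> M" for j
    unfolding M_def by (rule Max_ge) auto
  have "mode_weight n \<le> 1 + (\<Sum>j\<in>(UNIV :: 'q set). M)"
    unfolding mode_weight_def by (intro add_left_mono sum_mono M)
  also have "\<dots> \<le> max 1 M + real CARD('q) * max 1 M"
    by (intro add_mono) auto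
  finally have "mode_weight n ^ k \<le> ((1 + real CARD('q)) * max 1 M) ^ k"
    using mode_weight_ge_1[of n] by (intro power_mono) (auto simp: algebra_simps)
  also have "\<dots> = (1 + real CARD('q)) ^ k * max 1 M ^ k"
    by (rule power_mult_distrib)
  also have "max 1 M ^ k \<le> 1 + (\<Sum>i\<in>UNIV. \<bar>real_of_int (n $ i)\<bar> ^ k)"
  proof -
    have "M ^ k \<le> (\<Sum>i\<in>UNIV. \<bar>real_of_int (n $ i)\<bar> ^ k)"
      unfolding i by (rule member_le_sum) auto
    moreover have "0 \<le> M ^ k"
      by (simp add: i)
    ultimately show ?thesis
      by (simp add: max_def)
  qed
  finally show ?thesis
    by (simp add: mult_left_mono)
qed

lemma rapid_fourier_coeff:
  fixes u :: "real ^ 'q::finite \<Rightarrow> complex"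
  assumes "\<And>k. class_C k u" and "\<And>x m. u (x + real_vec m) = u x"
  shows "rapid (fourier_coeff u)"
  unfolding rapid_def
proof
  fix k
  have "\<forall>i. \<exists>C. \<forall>n. cmod (fourier_coeff u n) * \<bar>real_of_int (n $ i)\<bar> ^ k \<le> C"
    using fourier_coeff_coordinate_decay[OF assms] by blast
  then obtain C where C: "\<And>i n. cmod (fourier_coeff u n) * \<bar>real_of_int (n $ i)\<bar> ^ k \<le> C i"
    by metis
  obtain D where D: "\<And>n. cmod (fourier_coeff u n) \<le> D"
    using fourier_coeff_coordinate_decay[OF assms, of undefined 0] by auto
  have "cmod (fourier_coeff u n) * mode_weight n ^ k \<le>
      (1 + real CARD('q)) ^ k * (D + (\<Sum>i\<in>UNIV. C i))" for n
  proof -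
    have "cmod (fourier_coeff u n) * mode_weight n ^ k \<le> cmod (fourier_coeff u n) *
        ((1 + real CARD('q)) ^ k * (1 + (\<Sum>i\<in>UNIV. \<bar>real_of_int (n $ i)\<bar> ^ k)))"
      by (intro mult_left_mono mode_weight_power_le) simp
    also have "\<dots> = (1 + real CARD('q)) ^ k * (cmod (fourier_coeff u n) +
        (\<Sum>i\<in>UNIV. cmod (fourier_coeff u n) * \<bar>real_of_int (n $ i)\<bar> ^ k))"
      by (simp add: algebra_simps sum_distrib_left)
    also have "\<dots> \<le> (1 + real CARD('q)) ^ k * (D + (\<Sum>i\<in>UNIV. C i))"
      by (intro mult_left_mono add_mono D sum_mono C) simp
    finally show ?thesis .
  qed
  then show "\<exists>C. \<forall>n. cmod (fourier_coeff u n) * mode_weight n ^ k \<le> C"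
    by blast
qed

section \<open>Completeness of the characters\<close>

lift_definition torus_character :: "int ^ 'q::finite \<Rightarrow> 'q torus \<Rightarrow> complex" is character
proof -
  fix n :: "int ^ 'q" and x y :: "real ^ 'q"
  assume "\<exists>m :: int ^ 'q. x - y = real_vec m"
  then obtain m :: "int ^ 'q" where "x = y + real_vec m"
    by (metis add.commute diff_add_cancel)
  then show "character n x = character n y"
    by (simp add: character_add_right)
qed

lemma continuous_on_torus_character: "continuous_on S (torus_character n)"
proof -
  have "continuous_on UNIV (torus_character n)"
    unfolding continuous_on_torus_iff torus_character.abs_eq by (rule continuous_on_character)
  then show ?thesis
    by (rule continuous_on_subset) simp
qed

lemma torus_character_separates:
  assumes "\<And>n. torus_character n s = torus_character n t"
  shows "s = t"
proof -
  obtain x y where xy: "s = torus_proj x" "t = torus_proj y"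
    using torus_proj_surj[of s] torus_proj_surj[of t] by blast
  have "\<exists>k. x $ i - y $ i = real_of_int k" for i
  proof -
    have "character (axis i 1) x = character (axis i 1) y"
      using assms[of "axis i 1"] by (simp add: xy torus_character.abs_eq)
    moreover have "real_vec (axis i 1) = axis i 1"
      by (simp add: vec_eq_iff axis_def)
    ultimately have "cis (2 * pi * (x $ i)) = cis (2 * pi * (y $ i))"
      by (simp add: character_def inner_axis' )
    then have "cis (2 * pi * (x $ i) - 2 * pi * (y $ i)) = 1"
      by (simp add: cis_divide[symmetric])
    then have "cos (2 * pi * (x $ i) - 2 * pi * (y $ i)) = 1"
      by (metis cis.simps(1) one_complex.simps(1))
    then obtain k :: int where "2 * pi * (x $ i) - 2 * pi * (y $ i) = real_of_int k * 2 * pi"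
      by (auto simp: cos_one_2pi_int)
    then have "2 * pi * (x $ i - y $ i) = 2 * pi * real_of_int k"
      by (simp add: algebra_simps)
    then show ?thesis
      by auto
  qed
  then obtain k where "\<And>i. x $ i - y $ i = real_of_int (k i)"
    by metis
  then have "x - y = real_vec (\<chi> i. k i)"
    by (simp add: vec_eq_iff)
  then show ?thesis
    unfolding xy torus_proj_eq_iff by blast
qed

text \<open>Points are separated by a continuous character; the Stone-Weierstrass theorem below is
  stated for Hausdorff spaces.\<close>

instance torus :: (finite) t2_space
proof
  fix s t :: "'a torus"
  assume "s \<noteq> t"
  then obtain n where "torus_character n s \<noteq> torus_character n t"
    using torus_character_separates by blast
  then obtain U V where UV: "open U" "open V" "torus_character n s \<in> U" "torus_character n t \<in> V"
      "U \<inter> V = {}"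
    using hausdorff by metis
  have "open (torus_character n -` U)" "open (torus_character n -` V)"
    using continuous_on_torus_character[of UNIV n] UV by (auto simp: continuous_on_open_vimage)
  then show "\<exists>U V. open U \<and> open V \<and> s \<in> U \<and> t \<in> V \<and> U \<inter> V = {}"
    using UV by (intro exI[of _ "torus_character n -` U"] exI[of _ "torus_character n -` V"]) auto
qed

lemma ex_representative:
  fixes x :: "real ^ 'q::finite"
  obtains m where "x + real_vec m \<in> cbox 0 1"
proof
  show "x + real_vec (\<chi> i. - \<lfloor>x $ i\<rfloor>) \<in> cbox 0 1"
    by (auto simp: mem_box_cart) linarith+
qed

lemma torus_proj_add_real_vec [simp]: "torus_proj (x + real_vec m) = torus_proj x"
  by (auto simp: torus_proj_eq_iff)

lemma compact_torus: "compact (UNIV :: 'q::finite torus set)"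
proof -
  have "t \<in> torus_proj ` cbox 0 1" for t :: "'q torus"
    by (metis ex_representative image_eqI torus_proj_add_real_vec torus_proj_surj)
  then have "UNIV = torus_proj ` cbox 0 (1 :: real ^ 'q)"
    by blast
  moreover have "continuous_on (cbox 0 1) (torus_proj :: real ^ 'q \<Rightarrow> _)"
    by (rule continuous_on_subset[OF continuous_on_torus_proj]) simp
  ultimately show ?thesis
    using compact_continuous_image compact_cbox by metis
qed

inductive trig_poly :: "(real ^ 'q::finite \<Rightarrow> complex) \<Rightarrow> bool" where
  monomial: "trig_poly (\<lambda>x. c * character n x)"
| add: "trig_poly f \<Longrightarrow> trig_poly g \<Longrightarrow> trig_poly (\<lambda>x. f x + g x)"

lemma trig_poly_mult:
  assumes "trig_poly f" "trig_poly g"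
  shows "trig_poly (\<lambda>x. f x * g x)"
  using assms
proof (induction arbitrary: g rule: trig_poly.induct)
  case (monomial c m)
  from monomial.prems show ?case
  proof (induction rule: trig_poly.induct)
    case (monomial d n)
    have "c * character m x * (d * character n x) = (c * d) * character (m + n) x" for x
      by (simp add: character_add_left)
    then show ?case
      by (simp only: trig_poly.monomial)
  next
    case (add f g)
    then show ?case
      by (simp only: distrib_left trig_poly.add)
  qed
next
  case (add f f')
  then show ?case
    by (simp only: distrib_right trig_poly.add)
qed

lemma continuous_on_trig_poly: "trig_poly f \<Longrightarrow> continuous_on S f"
  by (induction rule: trig_poly.induct) (auto intro!: continuous_intros)

text \<open>Stone-Weierstrass concerns real functions, so the ring consists of those whose pullbacks
  are trigonometric polynomials with complex coefficients.\<close>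

interpretation trig: function_ring_on
  "{g :: 'q::finite torus \<Rightarrow> real. trig_poly (\<lambda>x. of_real (g (torus_proj x)))}" UNIV
proof
  show "compact (UNIV :: 'q torus set)"
    by (rule compact_torus)
next
  fix f :: "'q torus \<Rightarrow> real"
  assume "f \<in> {g. trig_poly (\<lambda>x. of_real (g (torus_proj x)))}"
  then have "continuous_on UNIV (\<lambda>x. Re (of_real (f (torus_proj x))))"
    by (intro continuous_intros continuous_on_trig_poly) simp
  then show "continuous_on UNIV f"
    by (simp add: continuous_on_torus_iff)
next
  show "(\<lambda>_. c) \<in> {g. trig_poly (\<lambda>x. of_real (g (torus_proj x)))}" for c
    using monomial[of "of_real c" 0] by simp
next
  fix s t :: "'q torus"
  assume "s \<noteq> t"
  then obtain n where n: "torus_character n s \<noteq> torus_character n t"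
    using torus_character_separates by blast
  \<comment> \<open>Real and imaginary parts of a character are combinations of the characters of
    \<open>n\<close> and \<open>- n\<close>, and one of the two parts separates the points.\<close>
  have "of_real (Re (torus_character n (torus_proj x))) =
      1/2 * character n x + 1/2 * character (- n) x" for x
    by (simp add: torus_character.abs_eq character_minus complex_eq_iff)
  then have "trig_poly (\<lambda>x. of_real (Re (torus_character n (torus_proj x))))"
    by (simp only: trig_poly.intros)
  moreover have "of_real (Im (torus_character n (torus_proj x))) =
      (- \<i>/2) * character n x + (\<i>/2) * character (- n) x" for x
    by (simp add: torus_character.abs_eq character_minus complex_eq_iff)
  then have "trig_poly (\<lambda>x. of_real (Im (torus_character n (torus_proj x))))"
    by (simp only: trig_poly.intros)
  moreover have "Re (torus_character n s) \<noteq> Re (torus_character n t) \<or>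
      Im (torus_character n s) \<noteq> Im (torus_character n t)"
    using n by (simp add: complex_eq_iff)
  ultimately show "\<exists>f\<in>{g. trig_poly (\<lambda>x. of_real (g (torus_proj x)))}. f s \<noteq> f t"
    by (elim disjE) (rule bexI[of _ "\<lambda>t. Re (torus_character n t)"], simp, simp,
        rule bexI[of _ "\<lambda>t. Im (torus_character n t)"], simp, simp)
qed (simp_all add: trig_poly.add trig_poly_mult)

text \<open>Such a \<open>w\<close> is orthogonal to all trigonometric polynomials. Approximating it
  within \<open>e\<close> by one of them bounds the integral of its square by \<open>e\<close> times
  the integral of its modulus, so the square has integral 0.\<close>

lemma fourier_coeff_eq_0_real:
  fixes w :: "'q::finite torus \<Rightarrow> real"
  assumes cont: "continuous_on UNIV w" and 0: "\<And>n. fourier_coeff (\<lambda>x. of_real (w (torus_proj x))) n = 0"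
  shows "w t = 0"
proof -
  define v where "v x = w (torus_proj x)" for x
  have v: "continuous_on S v" for S
    using cont unfolding continuous_on_torus_iff v_def [abs_def] by (rule continuous_on_subset) simp
  have orth: "((\<lambda>x. of_real (v x) * f x) has_integral 0) (cbox 0 1)" if "trig_poly f" for f
    using that
  proof induction
    case (monomial c n)
    have "((\<lambda>x. of_real (v x) * character (- (- n)) x) has_integral
        fourier_coeff (\<lambda>x. of_real (w (torus_proj x))) (- n)) (cbox 0 1)"
      unfolding fourier_coeff_def v_def
      by (intro integrable_integral fourier_coeff_integrable continuous_intros)
        (use cont in \<open>simp add: continuous_on_torus_iff\<close>)
    from has_integral_mult_right[OF this, of c] show ?case
      by (simp add: 0 mult_ac)
  next
    case (add f g)
    from has_integral_add[OF add.IH] show ?case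
      by (simp add: distrib_left)
  qed
  define M where "M = integral (cbox 0 1) (\<lambda>x. \<bar>v x\<bar>)"
  have M: "((\<lambda>x. \<bar>v x\<bar>) has_integral M) (cbox 0 1)"
    unfolding M_def by (intro integrable_integral integrable_continuous continuous_intros v)
  have sq: "((\<lambda>x. (v x)\<^sup>2) has_integral integral (cbox 0 1) (\<lambda>x. (v x)\<^sup>2)) (cbox 0 1)"
    by (intro integrable_integral integrable_continuous continuous_intros v)
  have le: "integral (cbox 0 1) (\<lambda>x. (v x)\<^sup>2) \<le> e * M" if "e > 0" for e
  proof -
    obtain g where g: "trig_poly (\<lambda>x. complex_of_real (g (torus_proj x)))" "\<And>t. \<bar>w t - g t\<bar> < e"
      using trig.Stone_Weierstrass_basic[OF cont \<open>e > 0\<close>] by auto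
    have "((\<lambda>x. Re (of_real (v x) * of_real (g (torus_proj x)))) has_integral Re 0) (cbox 0 1)"
      by (rule has_integral_Re[OF orth[OF g(1)]])
    then have "((\<lambda>x. v x * g (torus_proj x)) has_integral 0) (cbox 0 1)"
      by simp
    from has_integral_diff[OF sq this]
    have "((\<lambda>x. (v x)\<^sup>2 - v x * g (torus_proj x)) has_integral
        integral (cbox 0 1) (\<lambda>x. (v x)\<^sup>2)) (cbox 0 1)"
      by simp
    moreover note has_integral_mult_right[OF M, of e]
    ultimately show ?thesis
    proof (rule has_integral_le)
      fix x
      have "(v x)\<^sup>2 - v x * g (torus_proj x) \<le> \<bar>v x\<bar> * \<bar>v x - g (torus_proj x)\<bar>"
        by (metis abs_ge_self abs_mult power2_eq_square right_diff_distrib)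
      also have "\<dots> \<le> \<bar>v x\<bar> * e"
        using g(2)[of "torus_proj x"] by (intro mult_left_mono) (simp_all add: v_def)
      finally show "(v x)\<^sup>2 - v x * g (torus_proj x) \<le> e * \<bar>v x\<bar>"
        by (simp add: mult.commute)
    qed
  qed
  have "0 \<le> M"
    unfolding M_def by (rule integral_nonneg[OF has_integral_integrable[OF M]]) simp
  have "integral (cbox 0 1) (\<lambda>x. (v x)\<^sup>2) \<le> 0"
  proof (rule field_le_epsilon)
    fix e :: real assume "0 < e"
    \<comment> \<open>The denominator \<open>M + 1\<close> is positive even if \<open>M\<close> is
      0.\<close>
    have "integral (cbox 0 1) (\<lambda>x. (v x)\<^sup>2) \<le> e / (M + 1) * M"
      using \<open>0 < e\<close> \<open>0 \<le> M\<close> by (intro le) simp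
    also have "\<dots> \<le> e"
      using \<open>0 < e\<close> \<open>0 \<le> M\<close> by (simp add: field_simps)
    finally show "integral (cbox 0 1) (\<lambda>x. (v x)\<^sup>2) \<le> 0 + e"
      by simp
  qed
  moreover have "0 \<le> integral (cbox 0 1) (\<lambda>x. (v x)\<^sup>2)"
    by (rule integral_nonneg[OF has_integral_integrable[OF sq]]) simp
  ultimately have "integral (cbox 0 1) (\<lambda>x. (v x)\<^sup>2) = 0"
    by simp
  moreover have "box 0 (1 :: real ^ 'q) \<noteq> {}"
    by (simp add: interval_ne_empty_cart)
  ultimately have v0: "v x = 0" if "x \<in> cbox 0 1" for x
    using that integral_cbox_eq_0_iff[of 0 1 "\<lambda>x. (v x)\<^sup>2"] v by (auto intro!: continuous_intros)
  obtain x where x: "t = torus_proj x"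
    using torus_proj_surj by blast
  obtain m where "x + real_vec m \<in> cbox 0 1"
    by (rule ex_representative)
  from v0[OF this] show ?thesis
    by (simp add: v_def x)
qed

lemma torus_proj_rep_torus: "torus_proj (rep_torus t) = t"
  by (rule Quotient_abs_rep[OF Quotient_torus])

text \<open>Through \<open>rep_torus\<close> a periodic function on the universal cover is read as a
  function on the torus, independently of the representative chosen.\<close>

lemma rep_torus_periodic:
  assumes "\<And>x m. u (x + real_vec m) = u x"
  shows "u (rep_torus (torus_proj x)) = u x"
proof -
  obtain m where "rep_torus (torus_proj x) - x = real_vec m"
    using torus_proj_rep_torus torus_proj_eq_iff by metis
  then have "rep_torus (torus_proj x) = x + real_vec m"
    by (simp add: diff_eq_eq add.commute)
  then show ?thesis
    using assms by simp
qed

text \<open>Conjugation exchanges the coefficients at \<open>n\<close> and \<open>- n\<close>, so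
  real and imaginary part have vanishing coefficients too and the real case applies to each.\<close>

lemma fourier_coeff_eq_0:
  fixes w :: "real ^ 'q::finite \<Rightarrow> complex"
  assumes cont: "continuous_on UNIV w" and per: "\<And>x m. w (x + real_vec m) = w x"
    and 0: "\<And>n. fourier_coeff w n = 0"
  shows "w x = 0"
proof -
  have coeff: "((\<lambda>x. w x * character n x) has_integral 0) (cbox 0 1)" for n
    using integrable_integral[OF fourier_coeff_integrable[OF cont, of n]] 0[of "- n"]
    by (simp add: fourier_coeff_def)
  have cnj: "((\<lambda>x. cnj (w x) * character n x) has_integral 0) (cbox 0 1)" for n
    using has_integral_cnj[of "\<lambda>x. w x * character (- n) x" 0] coeff[of "- n"]
    by (simp add: comp_def character_minus)
  have rep: "w (rep_torus (torus_proj x)) = w x" for x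
    using per by (rule rep_torus_periodic)
  have "((\<lambda>x. of_real (Re (w x)) * character n x) has_integral 0) (cbox 0 1)" for n
    using has_integral_mult_right[OF has_integral_add[OF coeff[of n] cnj[of n]], of "1/2"]
    by (simp add: complex_add_cnj flip: distrib_right)
  then have "fourier_coeff (\<lambda>x. of_real (Re (w (rep_torus (torus_proj x))))) n = 0" for n
    unfolding fourier_coeff_def rep by (rule integral_unique)
  then have "Re (w (rep_torus t)) = 0" for t
    by (rule fourier_coeff_eq_0_real[rotated])
      (auto simp: continuous_on_torus_iff rep intro!: continuous_intros cont)
  moreover have "((\<lambda>x. of_real (Im (w x)) * character n x) has_integral 0) (cbox 0 1)" for n
  proof -
    have "- \<i> / 2 * (w x * character n x - cnj (w x) * character n x) =
        of_real (Im (w x)) * character n x" for x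
      by (simp add: complex_eq_iff)
    then show ?thesis
      using has_integral_mult_right[OF has_integral_diff[OF coeff[of n] cnj[of n]], of "- \<i> / 2"]
      by simp
  qed
  then have "fourier_coeff (\<lambda>x. of_real (Im (w (rep_torus (torus_proj x))))) n = 0" for n
    unfolding fourier_coeff_def rep by (rule integral_unique)
  then have "Im (w (rep_torus t)) = 0" for t
    by (rule fourier_coeff_eq_0_real[rotated])
      (auto simp: continuous_on_torus_iff rep intro!: continuous_intros cont)
  ultimately show ?thesis
    using rep[of x] by (metis complex_eq_iff zero_complex.simps)
qed

text \<open>The series converges rapidly and has the same coefficients as \<open>u\<close>, so the
  continuous difference vanishes by completeness.\<close>

theorem trig_series_fourier_coeff:
  fixes u :: "real ^ 'q::finite \<Rightarrow> complex"
  assumes smooth: "\<And>k. class_C k u" and per: "\<And>x m. u (x + real_vec m) = u x"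
  shows "trig_series (fourier_coeff u) x = u x"
proof -
  have rapid: "rapid (fourier_coeff u)"
    using assms by (rule rapid_fourier_coeff)
  have cont: "continuous_on UNIV u"
    using smooth[of 0] by simp
  have "u x - trig_series (fourier_coeff u) x = 0"
  proof (rule fourier_coeff_eq_0)
    show "continuous_on UNIV (\<lambda>x. u x - trig_series (fourier_coeff u) x)"
      by (intro continuous_intros cont continuous_on_trig_series rapid)
    show "u (x + real_vec m) - trig_series (fourier_coeff u) (x + real_vec m) =
        u x - trig_series (fourier_coeff u) x" for x m
      by (simp add: per)
    show "fourier_coeff (\<lambda>x. u x - trig_series (fourier_coeff u) x) n = 0" for n
    proof -
      have "((\<lambda>x. u x * character (- n) x - trig_series (fourier_coeff u) x * character (- n) x)
          has_integral (fourier_coeff u n - fourier_coeff (trig_series (fourier_coeff u)) n)) (cbox 0 1)"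
        unfolding fourier_coeff_def [of _ n]
        by (intro has_integral_diff integrable_integral fourier_coeff_integrable cont
            continuous_on_trig_series rapid)
      then show ?thesis
        unfolding fourier_coeff_trig_series[OF rapid]
        by (simp add: fourier_coeff_def[of "\<lambda>x. u x - _ x"] left_diff_distrib integral_unique)
    qed
  qed
  then show ?thesis
    by simp
qed

section \<open>Smooth cocycles and their Fourier coefficients\<close>

lemma class_C_bounded_linear:
  assumes "bounded_linear T"
  shows "class_C k g \<Longrightarrow> class_C k (\<lambda>x. T (g x))"
proof (induction k arbitrary: g)
  case 0
  then show ?case
    by (simp add: bounded_linear.continuous_on[OF assms])
next
  case (Suc k)
  then obtain g' where g': "\<And>x. (g has_derivative g' x) (at x)" "\<And>v. class_C k (\<lambda>x. g' x v)"
    by auto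
  show ?case
    unfolding class_C.simps
    by (intro exI[of _ "\<lambda>x v. T (g' x v)"] conjI allI bounded_linear.has_derivative[OF assms]
        g'(1) Suc.IH g'(2))
qed

lemma smooth_on_torus_trig_series:
  assumes "rapid a"
  shows "smooth_on_torus (\<lambda>t. Re (trig_series a (rep_torus t)))"
    and "smooth_on_torus (\<lambda>t. Im (trig_series a (rep_torus t)))"
  unfolding smooth_on_torus_def rep_torus_periodic[of "trig_series a", OF trig_series_real_vec]
  by (intro allI class_C_bounded_linear[OF bounded_linear_Re] class_C_bounded_linear[OF bounded_linear_Im]
      class_C_trig_series assms)+

lemma smooth_on_torus_obtain_series:
  assumes "smooth_on_torus f"
  obtains a where "rapid a" "\<And>x. trig_series a x = of_real (f (torus_proj x))"
proof
  let ?u = "\<lambda>x. complex_of_real (f (torus_proj x))"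
  have u: "class_C k ?u" "?u (x + real_vec m) = ?u x" for k x m
    using class_C_bounded_linear[OF bounded_linear_of_real] assms
    by (auto simp: smooth_on_torus_def)
  show "rapid (fourier_coeff ?u)"
    using u by (rule rapid_fourier_coeff)
  show "trig_series (fourier_coeff ?u) x = ?u x" for x
    using u by (rule trig_series_fourier_coeff)
qed

lemma trig_series_eqD:
  assumes "rapid a" "rapid b" "\<And>x. trig_series a x = trig_series b x"
  shows "a = b"
proof
  fix n
  have "trig_series a = trig_series b"
    using assms(3) by blast
  then show "a n = b n"
    using fourier_coeff_trig_series[OF assms(1), of n] fourier_coeff_trig_series[OF assms(2), of n]
    by simp
qed

lemma trig_series_add:
  assumes "rapid a" "rapid b"
  shows "trig_series (\<lambda>n. a n + b n) x = trig_series a x + trig_series b x"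
proof (rule has_sum_unique)
  show "((\<lambda>n. (a n + b n) * character n x) has_sum trig_series (\<lambda>n. a n + b n) x) UNIV"
    by (rule has_sum_trig_series[OF rapid_add[OF assms]])
  show "((\<lambda>n. (a n + b n) * character n x) has_sum trig_series a x + trig_series b x) UNIV"
    using has_sum_add[OF has_sum_trig_series[OF assms(1)] has_sum_trig_series[OF assms(2)]]
    by (simp add: distrib_right)
qed

lemma rapid_cmult: "rapid a \<Longrightarrow> rapid (\<lambda>n. c * a n)"
  by (rule rapid_le[where K = "cmod c" and a = a]) (simp_all add: norm_mult)

lemma trig_series_cmult:
  assumes "rapid a"
  shows "trig_series (\<lambda>n. c * a n) x = c * trig_series a x"
proof (rule has_sum_unique)
  show "((\<lambda>n. c * a n * character n x) has_sum trig_series (\<lambda>n. c * a n) x) UNIV"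
    by (rule has_sum_trig_series[OF rapid_cmult[OF assms]])
  show "((\<lambda>n. c * a n * character n x) has_sum c * trig_series a x) UNIV"
    using has_sum_cmult_right[OF has_sum_trig_series[OF assms], of c] by (simp add: mult.assoc)
qed

lemma rapid_constant: "rapid (\<lambda>n. if n = 0 then c else 0)"
  by (rule rapid_finite_support) (rule finite_subset[of _ "{0}"], auto)

lemma trig_series_constant: "trig_series (\<lambda>n. if n = 0 then c else 0) x = c"
proof (rule has_sum_unique[OF has_sum_trig_series[OF rapid_constant]])
  have "((\<lambda>n. (if n = 0 then c else 0) * character n x) has_sum
      (\<Sum>n\<in>{0}. (if n = 0 then c else 0) * character n x)) {0}"
    by (rule has_sum_finite) simp
  then show "((\<lambda>n. (if n = 0 then c else 0) * character n x) has_sum c) UNIV"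
    by (subst has_sum_cong_neutral[where T = "{0}"]) auto
qed

section \<open>Affine actions on Fourier coefficients\<close>

lemma mode_weight_mult_le: "\<exists>K. \<forall>n. mode_weight (B *v n) \<le> K * mode_weight n"
proof -
  define M where "M = (\<Sum>i\<in>UNIV. \<Sum>j\<in>UNIV. \<bar>real_of_int (B $ i $ j)\<bar>)"
  have "mode_weight (B *v n) \<le> (1 + M) * mode_weight n" for n
  proof -
    have "\<bar>real_of_int ((B *v n) $ i)\<bar> \<le> (\<Sum>j\<in>UNIV. \<bar>real_of_int (B $ i $ j)\<bar>) * mode_weight n" for i
    proof -
      have "\<bar>real_of_int ((B *v n) $ i)\<bar> \<le> (\<Sum>j\<in>UNIV. \<bar>real_of_int (B $ i $ j)\<bar> * \<bar>real_of_int (n $ j)\<bar>)"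
        unfolding matrix_vector_mult_def vec_lambda_beta of_int_sum
        by (rule order_trans[OF sum_abs]) (simp add: abs_mult)
      also have "\<dots> \<le> (\<Sum>j\<in>UNIV. \<bar>real_of_int (B $ i $ j)\<bar> * mode_weight n)"
        by (intro sum_mono mult_left_mono abs_nth_le_mode_weight) simp
      finally show ?thesis
        by (simp add: sum_distrib_right)
    qed
    then have "(\<Sum>i\<in>UNIV. \<bar>real_of_int ((B *v n) $ i)\<bar>) \<le> M * mode_weight n"
      unfolding M_def sum_distrib_right[of _ UNIV "mode_weight n"] by (intro sum_mono) (simp add: sum_distrib_right)
    then show ?thesis
      unfolding mode_weight_def[of "B *v n"] using mode_weight_ge_1[of n] by (simp add: distrib_right)
  qed
  then show ?thesis
    by blast
qed

text \<open>The lifts may form an action only up to periods, so the locale fits both \<phi> with the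
  chosen \<alpha> and \<psi> with \<open>\<alpha>\<^sub>1\<close>.\<close>

locale lifted_affine_action =
  fixes \<phi> :: "int ^ 'p::finite \<Rightarrow> 'q::finite torus \<Rightarrow> 'q torus"
    and A :: "int ^ 'p \<Rightarrow> int ^ 'q ^ 'q" and \<alpha> :: "int ^ 'p \<Rightarrow> real ^ 'q"
  assumes action: "affine_action \<phi>"
    and lift: "\<phi> l (torus_proj x) = torus_proj (real_mat (A l) *v x + \<alpha> l)"
begin

definition \<tau> :: "int ^ 'p \<Rightarrow> int ^ 'q \<Rightarrow> int ^ 'q" where
  "\<tau> l n = transpose (A l) *v n"

definition \<theta> :: "int ^ 'p \<Rightarrow> int ^ 'q \<Rightarrow> complex" where
  "\<theta> l n = character n (\<alpha> l)"

lemma linear_part: "linear_part (\<phi> l) = A l"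
proof -
  have "\<phi> l t = torus_mat (A l) t + torus_proj (\<alpha> l)" for t
  proof -
    obtain x where "t = torus_proj x"
      using torus_proj_surj by blast
    then show ?thesis
      by (simp add: lift torus_mat.abs_eq plus_torus.abs_eq)
  qed
  then have "\<phi> l = (\<lambda>t. torus_mat (A l) t + torus_proj (\<alpha> l))"
    by blast
  then show ?thesis
    by (simp only: linear_part_affine)
qed

lemma character_lift: "character n (real_mat (A l) *v x + \<alpha> l) = \<theta> l n * character (\<tau> l n) x"
  by (simp add: character_add_right character_real_mat \<tau>_def \<theta>_def)

sublocale mode_action \<tau> \<theta>
proof
  have A_add: "A (l + l') = A l ** A l'" for l l'
    using linear_part_add[OF action, of l l'] by (simp add: linear_part)
  \<comment> \<open>An invertible idempotent matrix is the identity.\<close>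
  obtain C where "A 0 ** C = mat 1"
    using affine_action_linear_part(1)[OF action, of 0] unfolding linear_part invertible_def by blast
  moreover have "A 0 ** A 0 = A 0"
    using A_add[of 0 0] by simp
  ultimately have A_0: "A 0 = mat 1"
    by (metis matrix_mul_assoc matrix_mul_rid)
  fix l l' n
  show "\<tau> 0 n = n"
    by (simp add: \<tau>_def A_0 transpose_mat)
  \<comment> \<open>Transposition reverses products, hence the order of the two factors.\<close>
  show "\<tau> (l + l') n = \<tau> l' (\<tau> l n)"
    by (simp add: \<tau>_def A_add matrix_transpose_mul matrix_vector_mul_assoc del: transpose_matrix_vector)
  show "\<tau> l 0 = 0"
    by (simp add: \<tau>_def)
  show "cmod (\<theta> l n) = 1"
    by (simp add: \<theta>_def)
  show "\<theta> l 0 = 1"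
    by (simp add: \<theta>_def)
  \<comment> \<open>The translations satisfy the cocycle identity modulo integral vectors, on which
    characters are 1.\<close>
  have "torus_proj (\<alpha> (l + l')) = torus_proj (real_mat (A l) *v \<alpha> l' + \<alpha> l)"
    using affine_action_add[OF action, of l l' "torus_proj 0"] by (simp add: lift)
  then obtain m where "\<alpha> (l + l') - (real_mat (A l) *v \<alpha> l' + \<alpha> l) = real_vec m"
    unfolding torus_proj_eq_iff by blast
  then have "\<alpha> (l + l') = real_mat (A l) *v \<alpha> l' + \<alpha> l + real_vec m"
    by (simp add: diff_eq_eq add.commute)
  then show "\<theta> (l + l') n = \<theta> l n * \<theta> l' (\<tau> l n)"
    using character_lift[of n l "\<alpha> l'"] by (simp add: \<theta>_def character_add_right)
qed

text \<open>The coefficients of the composition of the series with \<open>\<phi> l\<close>.\<close>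

definition transported :: "int ^ 'p \<Rightarrow> (int ^ 'q \<Rightarrow> complex) \<Rightarrow> int ^ 'q \<Rightarrow> complex" where
  "transported l a m = \<theta> l (\<tau> (- l) m) * a (\<tau> (- l) m)"

lemma transported_\<tau>: "transported l a (\<tau> l n) = \<theta> l n * a n"
  by (simp add: transported_def \<tau>_cancel)

lemma rapid_transported:
  assumes "rapid a"
  shows "rapid (transported l a)"
  unfolding rapid_def
proof
  fix k
  obtain C where C: "\<And>n. cmod (a n) * mode_weight n ^ k \<le> C"
    using assms unfolding rapid_def by blast
  obtain K where K: "\<And>n. mode_weight (\<tau> l n) \<le> K * mode_weight n"
    using mode_weight_mult_le unfolding \<tau>_def by blast
  have "cmod (transported l a m) * mode_weight m ^ k \<le> \<bar>K\<bar> ^ k * C" for m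
  proof -
    define n where "n = \<tau> (- l) m"
    have m: "m = \<tau> l n"
      by (simp add: n_def \<tau>_cancel)
    have "mode_weight m \<le> \<bar>K\<bar> * mode_weight n"
      using K[of n] mode_weight_ge_1[of n] unfolding m
      by (smt (verit) mult_right_mono)
    then have "mode_weight m ^ k \<le> (\<bar>K\<bar> * mode_weight n) ^ k"
      using mode_weight_ge_1[of m] by (intro power_mono) auto
    then have "cmod (a n) * mode_weight m ^ k \<le> cmod (a n) * (\<bar>K\<bar> * mode_weight n) ^ k"
      by (intro mult_left_mono) auto
    also have "\<dots> = \<bar>K\<bar> ^ k * (cmod (a n) * mode_weight n ^ k)"
      by (simp add: power_mult_distrib mult_ac)
    also have "\<dots> \<le> \<bar>K\<bar> ^ k * C"
      by (intro mult_left_mono C) simp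
    finally show ?thesis
      by (simp add: m transported_\<tau> norm_mult \<theta>_unit)
  qed
  then show "\<exists>C. \<forall>n. cmod (transported l a n) * mode_weight n ^ k \<le> C"
    by blast
qed

lemma trig_series_lift:
  assumes "rapid a"
  shows "trig_series a (real_mat (A l) *v x + \<alpha> l) = trig_series (transported l a) x"
proof (rule has_sum_unique)
  show "((\<lambda>n. a n * character n (real_mat (A l) *v x + \<alpha> l)) has_sum
      trig_series a (real_mat (A l) *v x + \<alpha> l)) UNIV"
    by (rule has_sum_trig_series[OF assms])
  have "bij_betw (\<tau> l) UNIV UNIV"
    by (rule bij_betw_byWitness[where f' = "\<tau> (- l)"]) (auto simp: \<tau>_cancel)
  from has_sum_reindex_bij_betw[OF this, of "\<lambda>m. transported l a m * character m x"]
  have "((\<lambda>n. transported l a (\<tau> l n) * character (\<tau> l n) x) has_sum trig_series (transported l a) x) UNIV"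
    using has_sum_trig_series[OF rapid_transported[OF assms], of l x] by simp
  then show "((\<lambda>n. a n * character n (real_mat (A l) *v x + \<alpha> l)) has_sum
      trig_series (transported l a) x) UNIV"
    by (simp add: transported_\<tau> character_lift mult_ac)
qed

lemma trig_series_rep_lift:
  assumes "rapid a"
  shows "trig_series a (rep_torus (\<phi> l (torus_proj x))) = trig_series (transported l a) x"
  unfolding lift rep_torus_periodic[of "trig_series a", OF trig_series_real_vec]
  by (rule trig_series_lift[OF assms])

text \<open>A mode cocycle sums to a complex smooth cocycle, whose real and imaginary parts are real
  cocycles over \<phi>. Their primitives combine to a complex one, and the homomorphisms affect mode
  0 only.\<close>

lemma mode_rigid_of_cohomologically_rigid:
  assumes rigid: "cohomologically_rigid \<phi>"
  shows "mode_rigid \<tau> \<theta>"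
  unfolding mode_rigid_def
proof (intro allI impI)
  fix c assume "mode_cocycle \<tau> \<theta> c"
  then have rapid: "\<And>l. rapid (c l)"
    and c: "\<And>l l' n. c (l + l') (\<tau> l n) = c l (\<tau> l n) + \<theta> l n * c l' n"
    by (simp_all add: mode_cocycle_def)
  have c': "c (l + l') m = c l m + transported l (c l') m" for l l' m
    using c[of l l' "\<tau> (- l) m"] by (simp add: \<tau>_cancel transported_def)
  have series: "trig_series (c (l + l')) (rep_torus t) =
      trig_series (c l) (rep_torus t) + trig_series (c l') (rep_torus (\<phi> l t))" for l l' t
  proof -
    have "c (l + l') = (\<lambda>m. c l m + transported l (c l') m)"
      using c' by blast
    then have "trig_series (c (l + l')) (rep_torus t) =
        trig_series (c l) (rep_torus t) + trig_series (transported l (c l')) (rep_torus t)"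
      by (simp add: trig_series_add rapid rapid_transported)
    then show ?thesis
      using trig_series_rep_lift[OF rapid, of l' l "rep_torus t"] by (simp add: torus_proj_rep_torus)
  qed
  have cocycles: "smooth_cocycle \<phi> (\<lambda>l t. Re (trig_series (c l) (rep_torus t)))"
    "smooth_cocycle \<phi> (\<lambda>l t. Im (trig_series (c l) (rep_torus t)))"
    by (simp_all add: smooth_cocycle_def smooth_on_torus_trig_series rapid series)
  obtain h1 f1 where f1: "smooth_on_torus f1"
    and Re: "\<And>l t. Re (trig_series (c l) (rep_torus t)) = h1 l + f1 (\<phi> l t) - f1 t"
    using rigid[unfolded cohomologically_rigid_def, rule_format, OF cocycles(1)] by auto
  obtain h2 f2 where f2: "smooth_on_torus f2"
    and Im: "\<And>l t. Im (trig_series (c l) (rep_torus t)) = h2 l + f2 (\<phi> l t) - f2 t"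
    using rigid[unfolded cohomologically_rigid_def, rule_format, OF cocycles(2)] by auto
  obtain a1 where a1: "rapid a1" "\<And>x. trig_series a1 x = of_real (f1 (torus_proj x))"
    using smooth_on_torus_obtain_series[OF f1] by metis
  obtain a2 where a2: "rapid a2" "\<And>x. trig_series a2 x = of_real (f2 (torus_proj x))"
    using smooth_on_torus_obtain_series[OF f2] by metis
  define a where "a n = a1 n + \<i> * a2 n" for n
  have a: "rapid a"
    unfolding a_def by (intro rapid_add rapid_cmult a1 a2)
  have a_series: "trig_series a x = Complex (f1 (torus_proj x)) (f2 (torus_proj x))" for x
    unfolding a_def by (simp add: trig_series_add trig_series_cmult rapid_cmult a1 a2 Complex_eq)
  have a_eq: "c l n + a n = (if n = 0 then Complex (h1 l) (h2 l) else 0) + transported l a n" for l n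
  proof -
    have "(\<lambda>n. c l n + a n) = (\<lambda>n. (if n = 0 then Complex (h1 l) (h2 l) else 0) + transported l a n)"
    proof (rule trig_series_eqD)
      fix x
      have "trig_series (c l) x = trig_series (c l) (rep_torus (torus_proj x))"
        by (simp add: rep_torus_periodic)
      also have "\<dots> = Complex (h1 l) (h2 l) + trig_series a (real_mat (A l) *v x + \<alpha> l) - trig_series a x"
        by (simp add: complex_eq_iff Re Im a_series lift)
      finally show "trig_series (\<lambda>n. c l n + a n) x =
          trig_series (\<lambda>n. (if n = 0 then Complex (h1 l) (h2 l) else 0) + transported l a n) x"
        by (simp add: trig_series_add rapid a rapid_transported rapid_constant trig_series_constant
            trig_series_lift)
    qed (intro rapid_add rapid a rapid_transported rapid_constant)+
    then show ?thesis
      by (rule fun_cong)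
  qed
  have "c l (\<tau> l n) = \<theta> l n * a n - a (\<tau> l n)" if "n \<noteq> 0" for l n
    using a_eq[of l "\<tau> l n"] that by (simp add: transported_\<tau> \<tau>_eq_zero_iff eq_diff_eq)
  with a show "\<exists>f. rapid f \<and> (\<forall>l n. n \<noteq> 0 \<longrightarrow> c l (\<tau> l n) = \<theta> l n * f n - f (\<tau> l n))"
    by blast
qed

text \<open>The coefficients of a smooth cocycle form a mode cocycle. Its primitive off mode 0 sums
  to a smooth function with the required real part, and the coefficient at mode 0 is the
  homomorphism.\<close>

lemma cohomologically_rigid_of_mode_rigid:
  assumes rigid: "mode_rigid \<tau> \<theta>"
  shows "cohomologically_rigid \<phi>"
  unfolding cohomologically_rigid_def
proof (intro allI impI)
  fix c assume "smooth_cocycle \<phi> c"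
  then have smooth: "\<And>l. smooth_on_torus (c l)"
    and c: "\<And>l l' t. c (l + l') t = c l t + c l' (\<phi> l t)"
    by (simp_all add: smooth_cocycle_def)
  have "\<exists>a. rapid a \<and> (\<forall>x. trig_series a x = of_real (c l (torus_proj x)))" for l
    using smooth_on_torus_obtain_series[OF smooth[of l]] by metis
  then obtain a where rapid: "\<And>l. rapid (a l)"
    and a: "\<And>l x. trig_series (a l) x = of_real (c l (torus_proj x))"
    by metis
  have a_add: "a (l + l') m = a l m + transported l (a l') m" for l l' m
  proof -
    have "a (l + l') = (\<lambda>m. a l m + transported l (a l') m)"
    proof (rule trig_series_eqD)
      show "trig_series (a (l + l')) x = trig_series (\<lambda>m. a l m + transported l (a l') m) x" for x
        by (simp add: trig_series_add rapid rapid_transported a c lift flip: trig_series_lift)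
    qed (intro rapid_add rapid rapid_transported)+
    then show ?thesis
      by (rule fun_cong)
  qed
  then have "mode_cocycle \<tau> \<theta> a"
    by (simp add: mode_cocycle_def rapid transported_\<tau>)
  from mode_rigidE[OF rigid this] obtain f where f: "rapid f"
    "\<And>l n. n \<noteq> 0 \<Longrightarrow> a l (\<tau> l n) = \<theta> l n * f n - f (\<tau> l n)"
    by metis
  \<comment> \<open>Transport leaves the coefficient at mode 0 unchanged, so there the whole of
    \<open>a l 0\<close> remains.\<close>
  have a_eq: "a l m + f m = (if m = 0 then a l 0 else 0) + transported l f m" for l m
  proof (cases "m = 0")
    case True
    then show ?thesis
      by (simp add: transported_def \<tau>_zero \<theta>_zero)
  next
    case False
    then have "\<tau> (- l) m \<noteq> 0"
      by (simp add: \<tau>_eq_zero_iff)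
    from f(2)[OF this, of l] False show ?thesis
      by (simp add: \<tau>_cancel transported_def)
  qed
  have "c l t = Re (a l 0) + Re (trig_series f (rep_torus (\<phi> l t))) - Re (trig_series f (rep_torus t))"
    for l t
  proof -
    have "trig_series (\<lambda>m. a l m + f m) (rep_torus t) =
        trig_series (\<lambda>m. (if m = 0 then a l 0 else 0) + transported l f m) (rep_torus t)"
      by (simp only: a_eq)
    then have "of_real (c l t) + trig_series f (rep_torus t) =
        a l 0 + trig_series (transported l f) (rep_torus t)"
      by (simp add: trig_series_add rapid f rapid_transported rapid_constant trig_series_constant a
          torus_proj_rep_torus)
    then have "of_real (c l t) + trig_series f (rep_torus t) =
        a l 0 + trig_series f (rep_torus (\<phi> l t))"
      using trig_series_rep_lift[OF f(1), of l "rep_torus t"] by (simp add: torus_proj_rep_torus)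
    then have "Re (of_real (c l t) + trig_series f (rep_torus t)) =
        Re (a l 0 + trig_series f (rep_torus (\<phi> l t)))"
      by (rule arg_cong)
    then show ?thesis
      by simp
  qed
  moreover have "Re (a (l + l') 0) = Re (a l 0) + Re (a l' 0)" for l l'
    by (simp add: a_add transported_def \<tau>_zero \<theta>_zero)
  ultimately show "\<exists>h f. (\<forall>l l'. h (l + l') = h l + h l') \<and> smooth_on_torus f \<and>
      (\<forall>l x. c l x = h l + f (\<phi> l x) - f x)"
    using smooth_on_torus_trig_series(1)[OF f(1)]
    by (intro exI[of _ "\<lambda>l. Re (a l 0)"] exI[of _ "\<lambda>t. Re (trig_series f (rep_torus t))"]) simp
qed

end

section \<open>Passage to the modes divisible by \<open>s\<close>\<close>

lemma character_scale: "character (of_nat s *s n) x = character n (real s *\<^sub>R x)"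
proof -
  have "real_vec (of_nat s *s n) = real s *\<^sub>R real_vec n"
    by (simp add: vec_eq_iff)
  then show ?thesis
    by (simp add: character_def)
qed

lemma character_power: "character n x ^ s = character n (real s *\<^sub>R x)"
  unfolding character_def Complex.DeMoivre by (simp add: mult_ac)

lemma mode_weight_le_scale:
  assumes "s \<ge> 1"
  shows "mode_weight n \<le> mode_weight (of_nat s *s n)"
proof -
  have "1 * \<bar>real_of_int (n $ i)\<bar> \<le> real s * \<bar>real_of_int (n $ i)\<bar>" for i
    using assms by (intro mult_right_mono) auto
  then show ?thesis
    unfolding mode_weight_def by (intro add_left_mono sum_mono) (simp add: abs_mult)
qed

lemma mode_weight_scale_le:
  assumes "s \<ge> 1"
  shows "mode_weight (of_nat s *s n) \<le> real s * mode_weight n"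
  using assms by (simp add: mode_weight_def abs_mult distrib_left flip: sum_distrib_left)

text \<open>Cocycles are transported to the sublattice of the modes divisible by \<open>s\<close>.\<close>

lemma mode_rigid_scale:
  fixes \<tau> :: "int ^ 'p::finite \<Rightarrow> int ^ 'q::finite \<Rightarrow> int ^ 'q"
  assumes rigid: "mode_rigid \<tau> \<theta>" and "s \<ge> 1"
    and inv: "\<And>l n. \<tau> (- l) (\<tau> l n) = n"
    and \<tau>: "\<And>l n. \<tau> l (of_nat s *s n) = of_nat s *s \<tau> l n"
    and \<theta>: "\<And>l n. \<theta> l (of_nat s *s n) = \<theta>' l n"
  shows "mode_rigid \<tau> \<theta>'"
  unfolding mode_rigid_def
proof (intro allI impI)
  fix c assume "mode_cocycle \<tau> \<theta>' c"
  then have rapid: "\<And>l. rapid (c l)"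
    and c: "\<And>l l' n. c (l + l') (\<tau> l n) = c l (\<tau> l n) + \<theta>' l n * c l' n"
    by (simp_all add: mode_cocycle_def)
  let ?m = "\<lambda>n :: int ^ 'q. of_nat s *s n"
  have inj: "?m n = ?m n' \<longleftrightarrow> n = n'" for n n'
    using \<open>s \<ge> 1\<close> by (simp add: vec_eq_iff)
  \<comment> \<open>Extension by zero: the multiples of \<open>s\<close> and their complement are
    both invariant under \<tau>, so the cocycle identity can be checked on each separately.\<close>
  define b where "b l m = (if m \<in> range ?m then c l (inv ?m m) else 0)" for l m
  have b_scale: "b l (?m n) = c l n" for l n
    using inv_f_f[of ?m n] inj by (simp add: b_def inj_def)
  have b_0: "b l m = 0" if "m \<notin> range ?m" for l m
    using that by (simp add: b_def)
  have range: "\<tau> l m \<in> range ?m \<longleftrightarrow> m \<in> range ?m" for l m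
  proof
    assume "\<tau> l m \<in> range ?m"
    then obtain n where "\<tau> l m = ?m n"
      by blast
    then have "m = ?m (\<tau> (- l) n)"
      using inv[of l m] \<tau>[of "- l" n] by simp
    then show "m \<in> range ?m"
      by (rule range_eqI)
  next
    assume "m \<in> range ?m"
    then show "\<tau> l m \<in> range ?m"
      using \<tau> by auto
  qed
  have "mode_cocycle \<tau> \<theta> b"
    unfolding mode_cocycle_def
  proof (intro conjI allI)
    fix l
    show "rapid (b l)"
      unfolding rapid_def
    proof
      fix k
      obtain C where C: "\<And>n. cmod (c l n) * mode_weight n ^ k \<le> C"
        using rapid[of l] unfolding rapid_def by blast
      \<comment> \<open>The sign of \<open>C\<close> is what bounds the zero values of
        \<open>b\<close> outside the sublattice.\<close>
      have "0 \<le> C"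
        by (rule order_trans[OF _ C[of 0]]) (use mode_weight_ge_1[of "0 :: int ^ 'q"] in simp)
      have "cmod (b l m) * mode_weight m ^ k \<le> real s ^ k * C" for m
      proof (cases "m \<in> range ?m")
        case True
        then obtain n where m: "m = ?m n"
          by blast
        have "mode_weight m ^ k \<le> (real s * mode_weight n) ^ k"
          using mode_weight_ge_1[of m] mode_weight_scale_le[OF \<open>s \<ge> 1\<close>, of n]
          unfolding m by (intro power_mono) auto
        then have "cmod (c l n) * mode_weight m ^ k \<le> cmod (c l n) * (real s * mode_weight n) ^ k"
          by (intro mult_left_mono) auto
        also have "\<dots> = real s ^ k * (cmod (c l n) * mode_weight n ^ k)"
          by (simp add: power_mult_distrib mult_ac)
        also have "\<dots> \<le> real s ^ k * C"
          by (intro mult_left_mono C) simp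
        finally show ?thesis
          by (simp add: m b_scale)
      next
        case False
        then show ?thesis
          using \<open>0 \<le> C\<close> by (simp add: b_0)
      qed
      then show "\<exists>C. \<forall>n. cmod (b l n) * mode_weight n ^ k \<le> C"
        by blast
    qed
  next
    fix l l' m
    show "b (l + l') (\<tau> l m) = b l (\<tau> l m) + \<theta> l m * b l' m"
    proof (cases "m \<in> range ?m")
      case True
      then obtain n where "m = ?m n"
        by blast
      then show ?thesis
        by (simp add: b_scale \<tau> \<theta> c)
    next
      case False
      then show ?thesis
        by (simp add: b_0 range)
    qed
  qed
  from mode_rigidE[OF rigid this] obtain f where f: "rapid f"
    "\<And>l n. n \<noteq> 0 \<Longrightarrow> b l (\<tau> l n) = \<theta> l n * f n - f (\<tau> l n)"
    by metis
  have "rapid (\<lambda>n. f (?m n))"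
    unfolding rapid_def
  proof
    fix k
    obtain C where C: "\<And>n. cmod (f n) * mode_weight n ^ k \<le> C"
      using f(1) unfolding rapid_def by blast
    have "cmod (f (?m n)) * mode_weight n ^ k \<le> C" for n
    proof -
      have "mode_weight n ^ k \<le> mode_weight (?m n) ^ k"
        using mode_weight_ge_1[of n] mode_weight_le_scale[OF \<open>s \<ge> 1\<close>, of n]
        by (intro power_mono) auto
      then have "cmod (f (?m n)) * mode_weight n ^ k \<le> cmod (f (?m n)) * mode_weight (?m n) ^ k"
        by (intro mult_left_mono) auto
      then show ?thesis
        using C[of "?m n"] by linarith
    qed
    then show "\<exists>C. \<forall>n. cmod (f (?m n)) * mode_weight n ^ k \<le> C"
      by blast
  qed
  moreover have "c l (\<tau> l n) = \<theta>' l n * f (?m n) - f (?m (\<tau> l n))" if "n \<noteq> 0" for l n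
  proof -
    have "?m n \<noteq> 0"
      using that inj[of n 0] by simp
    from f(2)[OF this, of l] show ?thesis
      by (simp add: \<tau> \<theta> b_scale)
  qed
  ultimately show "\<exists>f. rapid f \<and> (\<forall>l n. n \<noteq> 0 \<longrightarrow> c l (\<tau> l n) = \<theta>' l n * f n - f (\<tau> l n))"
    by blast
qed

section \<open>The three implications for the principal action\<close>

theorem proposition2p3:
  fixes \<phi> \<psi> :: "int ^ 'p::finite \<Rightarrow> 'q::finite torus \<Rightarrow> 'q torus"
  assumes "affine_action \<phi>"
    and "principal_affine_action \<phi> \<psi>"
  shows "(free_action \<phi> \<longrightarrow> free_action \<psi>) \<and>
         (minimal_action \<phi> \<longrightarrow> minimal_action \<psi>) \<and>
         (cohomologically_rigid \<phi> \<longrightarrow> cohomologically_rigid \<psi>)"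
proof -
  have \<psi>_action: "affine_action \<psi>"
    using assms by (rule affine_action_principal)
  obtain A \<alpha> s \<beta> \<alpha>\<^sub>1 where
    lift: "\<And>l. is_lift (\<lambda>x. real_mat (A l) *v x + \<alpha> l) (\<phi> l)" and
    s: "s \<ge> (1::nat)" and
    \<alpha>\<^sub>1: "\<And>l. \<alpha>\<^sub>1 l = \<alpha> l - (1 / real s) *\<^sub>R real_vec (\<beta> l)" and
    \<psi>: "\<And>l x. \<psi> l (torus_proj x) = torus_proj (real_mat (A l) *v x + \<alpha>\<^sub>1 l)"
    using assms(2) unfolding principal_affine_action_def by blast
  have \<phi>: "\<phi> l (torus_proj x) = torus_proj (real_mat (A l) *v x + \<alpha> l)" for l x
    using lift by (simp add: is_lift_def)
  \<comment> \<open>The difference of the two translations is the projection of the integral vector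
    \<open>\<beta> l\<close> divided by \<open>s\<close>.\<close>
  have tors: "\<phi> l t - \<psi> l t \<in> torsion s" for l t
  proof -
    obtain x where "t = torus_proj x"
      using torus_proj_surj by blast
    then have "\<phi> l t - \<psi> l t = torus_proj ((1 / real s) *\<^sub>R real_vec (\<beta> l))"
      by (simp add: \<phi> \<psi> \<alpha>\<^sub>1 minus_torus.abs_eq)
    then show ?thesis
      by (simp add: torsion_def)
  qed
  have cont: "continuous_on UNIV (\<psi> l)" for l
    using \<psi> by (rule continuous_on_torus_affine)
  interpret \<phi>: lifted_affine_action \<phi> A \<alpha>
    using assms(1) \<phi> by (rule lifted_affine_action.intro)
  interpret \<psi>: lifted_affine_action \<psi> A \<alpha>\<^sub>1
    using \<psi>_action \<psi> by (rule lifted_affine_action.intro)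
  have "cohomologically_rigid \<psi>" if "cohomologically_rigid \<phi>"
  proof -
    have "mode_rigid \<psi>.\<tau> (\<lambda>l n. \<psi>.\<theta> l n ^ s)"
    proof (rule mode_rigid_scale[OF \<phi>.mode_rigid_of_cohomologically_rigid[OF that] s])
      show "\<phi>.\<tau> (- l) (\<phi>.\<tau> l n) = n" for l n
        by (rule \<phi>.\<tau>_cancel)
      show "\<phi>.\<tau> l (of_nat s *s n) = of_nat s *s \<phi>.\<tau> l n" for l n
        by (simp add: \<phi>.\<tau>_def vec_eq_iff matrix_vector_mult_def sum_distrib_left mult_ac
            del: transpose_matrix_vector)
      \<comment> \<open>After multiplication by \<open>s\<close> the two translations differ by the
        period \<open>\<beta> l\<close>, so \<phi> on the modes divisible by \<open>s\<close> has
        the \<open>s\<close>-th powers of the phases of \<psi>.\<close>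
      have "real s *\<^sub>R \<alpha> l = real s *\<^sub>R \<alpha>\<^sub>1 l + real_vec (\<beta> l)" for l
        using s by (simp add: \<alpha>\<^sub>1 scaleR_right_diff_distrib)
      then show "\<phi>.\<theta> l (of_nat s *s n) = \<psi>.\<theta> l n ^ s" for l n
        by (simp add: \<phi>.\<theta>_def \<psi>.\<theta>_def character_scale character_power character_add_right)
    qed
    then show ?thesis
      by (intro \<psi>.cohomologically_rigid_of_mode_rigid \<psi>.mode_rigid_of_power[OF _ s])
  qed
  moreover have "free_action \<psi>" if "free_action \<phi>"
    using assms(1) \<psi>_action s tors that by (rule free_action_torsion_perturbation)
  moreover have "minimal_action \<psi>" if "minimal_action \<phi>"
    using \<psi>_action cont s tors that by (rule minimal_action_torsion_perturbation)
  ultimately show ?thesis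
    by (intro conjI impI)
qed

end
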